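(* Let $\mathbf w=(w_0,\dots,w_n)$ be a vector of positive integers, $T=\{0,\dots,n\}$, and let $F=a_0x_0^{m_0}+\cdots+a_nx_n^{m_n}$ with $a_i\in\mathbb F_q^\times$ and positive integers $m_i$ such that $m_iw_i=d$ for all $i$, for a fixed integer $d$. Let $X=V(F)\subset\mathbb P^n_{\mathbf w}$ be the diagonal hypersurface over $\mathbb F_q$, $\mathcal X\subseteq\mathcal P_{\mathbf w}$ the associated closed substack, and assume $q\equiv1\pmod d$. Then $$Z_{\mathrm{tw}}(\mathcal X,t)=\prod_{\emptyset\ne S\subseteq T}\left[\ \prod_{j=0}^{|S|-1}\bigl(1-q^{j-1}t\bigr)^{-(-1)^{|S|-1-j}\binom{|S|-1}{j}k_S}\ \prod_{\chi\in\mathcal C_S}\bigl(1-q^{-1}\omega_{S,\chi}\,t\bigr)^{-(-1)^{|S|}k_S}\right].$$ In particular $Z_{\mathrm{tw}}(\mathcal X,t)$ is rational, and its reciprocal zeros and poles lie among the numbers $q^{j-1}$ with $0\le j\le n$ and the numbers $q^{-1}\omega_{S,\chi}$, which have absolute value $q^{\nu(\chi)/2-1}$.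
   Context: For $r\ge 1$, $A_X(q^r)$ is the number of orbits of $\mathbb F_{q^r}^\times$, acting by $\lambda\cdot(x_0,\dots,x_n)=(\lambda^{w_0}x_0,\dots,\lambda^{w_n}x_n)$, on the set of nonzero $x\in\mathbb F_{q^r}^{n+1}$ with $F(x)=0$; equivalently the number of isomorphism classes of $\mathcal X(\mathbb F_{q^r})$, where $\mathcal X=[(\widehat X\setminus\{0\})/\mathbb G_m]$ and $\widehat X=V(F)\subset\mathbb A^{n+1}$. The twist zeta function is $Z_{\mathrm{tw}}(\mathcal X,t)=\exp\bigl(\sum_{r\ge1}A_X(q^r)\,t^r/r\bigr)$. For nonempty $S\subseteq T$, $k_S=\gcd\{w_i:i\in S\}$. Fix a nontrivial additive character $\psi$ of $\mathbb F_q$; for a multiplicative character $\chi$ of $\mathbb F_q^\times$ put $G_q(\chi)=\sum_{u\in\mathbb F_q^\times}\chi(u)\psi(u)$, and let $\varepsilon$ be the trivial character (so $G_q(\varepsilon)=-1$). $\mathcal C_S$ is the set of tuples $\chi=(\chi_i)_{i\in S}$ of complex multiplicative characters of $\mathbb F_q^\times$ (trivial components allowed) with $\chi_i^{m_i}=\varepsilon$ for all $i\in S$ and $\prod_{i\in S}\chi_i=\varepsilon$. For $\chi\in\mathcal C_S$, $\omega_{S,\chi}=\prod_{i\in S}\bigl(-\overline{\chi_i}(a_i)\,G_q(\chi_i)\bigr)$ and $\nu(\chi)=\#\{i\in S:\chi_i\ne\varepsilon\}$. *)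

theory Defs
  imports
    "HOL-Algebra.Algebraic_Closure_Type"
    "HOL-Number_Theory.Cong"
    "HOL-Library.Cardinality"
    Complex_Main
begin

text \<open>
  The base field is the finite field type \<open>'k\<close>, so \<open>q = CARD('k)\<close>.
  Its extension of degree \<open>r \<ge> 1\<close> is realised inside the algebraic closure as the unique
  subfield with \<open>q ^ r\<close> elements, namely the fixed points of the \<open>r\<close>-th power of the
  Frobenius \<open>x \<mapsto> x ^ q\<close>.
\<close>
definition ext_field :: "nat \<Rightarrow> 'k::{field,finite} alg_closure set" where
  "ext_field r = {x. x ^ (CARD('k) ^ r) = x}"

text \<open>
  Vectors \<open>(x\<^sub>0, \<dots>, x\<^sub>n)\<close> are extensional functions on \<open>{..n}\<close>.
\<close>
definition diag_form ::
    "nat \<Rightarrow> (nat \<Rightarrow> 'k::field) \<Rightarrow> (nat \<Rightarrow> nat) \<Rightarrow> (nat \<Rightarrow> 'k alg_closure) \<Rightarrow> 'k alg_closure" where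
  "diag_form n a m x = (\<Sum>i\<le>n. to_ac (a i) * x i ^ m i)"

definition cone_points ::
    "nat \<Rightarrow> (nat \<Rightarrow> 'k::{field,finite}) \<Rightarrow> (nat \<Rightarrow> nat) \<Rightarrow> nat \<Rightarrow> (nat \<Rightarrow> 'k alg_closure) set" where
  "cone_points n a m r =
     {x \<in> {..n} \<rightarrow>\<^sub>E ext_field r. (\<exists>i\<le>n. x i \<noteq> 0) \<and> diag_form n a m x = 0}"

definition weighted_scale ::
    "nat \<Rightarrow> (nat \<Rightarrow> nat) \<Rightarrow> 'K::field \<Rightarrow> (nat \<Rightarrow> 'K) \<Rightarrow> (nat \<Rightarrow> 'K)" where
  "weighted_scale n w c x = (\<lambda>i\<in>{..n}. c ^ w i * x i)"

definition weighted_orbit ::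
    "nat \<Rightarrow> (nat \<Rightarrow> nat) \<Rightarrow> nat \<Rightarrow> (nat \<Rightarrow> 'k::{field,finite} alg_closure) \<Rightarrow>
     (nat \<Rightarrow> 'k alg_closure) set" where
  "weighted_orbit n w r x = (\<lambda>c. weighted_scale n w c x) ` (ext_field r - {0})"

text \<open>
  The number \<open>A\<^sub>X(q ^ r)\<close> of orbits, i.e. of isomorphism classes of the quotient stack over the field with \<open>q ^ r\<close> elements.
\<close>
definition orbit_count ::
    "nat \<Rightarrow> (nat \<Rightarrow> nat) \<Rightarrow> (nat \<Rightarrow> 'k::{field,finite}) \<Rightarrow> (nat \<Rightarrow> nat) \<Rightarrow> nat \<Rightarrow> nat" where
  "orbit_count n w a m r = card (weighted_orbit n w r ` cone_points n a m r)"

definition twist_zeta ::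
    "nat \<Rightarrow> (nat \<Rightarrow> nat) \<Rightarrow> (nat \<Rightarrow> 'k::{field,finite}) \<Rightarrow> (nat \<Rightarrow> nat) \<Rightarrow> complex fps" where
  "twist_zeta n w a m =
     fps_compose (fps_exp 1)
       (Abs_fps (\<lambda>r. if r = 0 then 0 else of_nat (orbit_count n w a m r) / of_nat r))"

definition weight_gcd :: "(nat \<Rightarrow> nat) \<Rightarrow> nat set \<Rightarrow> nat" where
  "weight_gcd w S = Gcd (w ` S)"

definition nontrivial_add_char :: "('k::field \<Rightarrow> complex) \<Rightarrow> bool" where
  "nontrivial_add_char \<psi> \<longleftrightarrow>
     \<psi> 0 = 1 \<and> (\<forall>x y. \<psi> (x + y) = \<psi> x * \<psi> y) \<and> (\<exists>x. \<psi> x \<noteq> 1)"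

text \<open>
  Multiplicative characters are functions on the whole field, normalised to be \<open>0\<close> at \<open>0\<close>
  (the trivial character included), so that they correspond bijectively to the
  homomorphisms from the group of units to the nonzero complex numbers.
\<close>
definition mult_char :: "('k::field \<Rightarrow> complex) \<Rightarrow> bool" where
  "mult_char \<chi> \<longleftrightarrow> \<chi> 0 = 0 \<and> \<chi> 1 = 1 \<and> (\<forall>x y. \<chi> (x * y) = \<chi> x * \<chi> y)"

definition trivial_mult_char :: "'k::field \<Rightarrow> complex" where
  "trivial_mult_char u = (if u = 0 then 0 else 1)"

definition gauss_sum :: "('k::{field,finite} \<Rightarrow> complex) \<Rightarrow> ('k \<Rightarrow> complex) \<Rightarrow> complex" where
  "gauss_sum \<psi> \<chi> = (\<Sum>u\<in>UNIV - {0}. \<chi> u * \<psi> u)"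

definition char_tuples ::
    "(nat \<Rightarrow> nat) \<Rightarrow> nat set \<Rightarrow> (nat \<Rightarrow> 'k::{field,finite} \<Rightarrow> complex) set" where
  "char_tuples m S =
     {\<chi> \<in> S \<rightarrow>\<^sub>E {\<chi>. mult_char \<chi>}.
        (\<forall>i\<in>S. \<forall>u. u \<noteq> 0 \<longrightarrow> \<chi> i u ^ m i = 1) \<and>
        (\<forall>u. u \<noteq> 0 \<longrightarrow> (\<Prod>i\<in>S. \<chi> i u) = 1)}"

definition omega ::
    "('k::{field,finite} \<Rightarrow> complex) \<Rightarrow> (nat \<Rightarrow> 'k) \<Rightarrow> nat set \<Rightarrow> (nat \<Rightarrow> 'k \<Rightarrow> complex) \<Rightarrow> complex" where
  "omega \<psi> a S \<chi> = (\<Prod>i\<in>S. - cnj (\<chi> i (a i)) * gauss_sum \<psi> (\<chi> i))"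

definition nontrivial_count :: "nat set \<Rightarrow> (nat \<Rightarrow> 'k::field \<Rightarrow> complex) \<Rightarrow> nat" where
  "nontrivial_count S \<chi> = card {i \<in> S. \<chi> i \<noteq> trivial_mult_char}"

text \<open>
  \<open>Z = P / Q\<close> in lowest terms. Then \<open>P\<close> and \<open>Q\<close> are unique up to a common nonzero
  constant; a reciprocal zero (pole) of \<open>Z\<close> is the inverse of a nonzero root of \<open>P\<close> (of \<open>Q\<close>).
\<close>
definition fps_reduced_fraction :: "complex fps \<Rightarrow> complex poly \<Rightarrow> complex poly \<Rightarrow> bool" where
  "fps_reduced_fraction Z P Q \<longleftrightarrow>
     coprime P Q \<and> poly Q 0 \<noteq> 0 \<and> Z * fps_of_poly Q = fps_of_poly P"

definition rational_fps :: "complex fps \<Rightarrow> bool" where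
  "rational_fps Z \<longleftrightarrow> (\<exists>P Q. fps_reduced_fraction Z P Q)"

definition reciprocal_zeros :: "complex fps \<Rightarrow> complex set" where
  "reciprocal_zeros Z =
     {inverse z | z. z \<noteq> 0 \<and> (\<exists>P Q. fps_reduced_fraction Z P Q \<and> poly P z = 0)}"

definition reciprocal_poles :: "complex fps \<Rightarrow> complex set" where
  "reciprocal_poles Z =
     {inverse z | z. z \<noteq> 0 \<and> (\<exists>P Q. fps_reduced_fraction Z P Q \<and> poly Q z = 0)}"

end

theory Submission
  imports Defs
begin

text \<open>
  An orbit supported on \<open>S\<close> has stabiliser of order \<open>k\<^sub>S\<close>, so over the extension of degree \<open>r\<close> there are
  \<open>k\<^sub>S * N\<^sub>S / (Q - 1)\<close> of them, where \<open>Q = q ^ r\<close> and \<open>N\<^sub>S\<close> counts the solutions with all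
  coordinates in \<open>S\<close> nonzero. Detecting the equation with the additive character \<open>\<psi> \<circ> Tr\<close> and
  \<open>m\<close>-th powers with the characters \<open>\<chi> \<circ> N\<close> (an element is an \<open>m\<close>-th power iff its norm is, because
  \<open>m\<close> divides \<open>q - 1\<close>) expresses \<open>N\<^sub>S\<close> by Gauss sums of the extension, which the Hasse-Davenport
  relation turns into powers of \<open>\<omega>\<close>. Hence the orbit count is an integral combination of \<open>r\<close>-th
  powers, and exponentiating yields the product.

  Hasse-Davenport is proved by Newton's identity. Let \<open>\<Lambda>\<close> be multiplicative on the monic
  polynomials over the base field. Such an \<open>f\<close> has \<open>deg f\<close> divisors of the form
  \<open>\<Prod>i<r. (X - x ^ (q ^ i))\<close>, counted over pairs of \<open>r \<ge> 1\<close> and \<open>x\<close> in the extension of degree \<open>r\<close>. For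
  \<open>C\<^sub>n = \<Sum>deg f = n. \<Lambda> f\<close> this gives \<open>n C\<^sub>n = \<Sum>r. S\<^sub>r C\<^sub>n\<^sub>-\<^sub>r\<close>, where \<open>S\<^sub>r\<close> is the Gauss sum over the
  extension if \<open>\<Lambda>\<close> is built from \<open>\<chi>\<close> and \<open>\<psi>\<close>; then \<open>C\<^sub>1\<close> is the Gauss sum over the base field and
  \<open>C\<^sub>n = 0\<close> for \<open>n \<ge> 2\<close>.
\<close>

subsection \<open>Finite fields inside the algebraic closure\<close>

text \<open>Multiplication by a nonzero \<open>x\<close> permutes the nonzero elements, so their
  product is unchanged by the factor \<open>x ^ (CARD('k) - 1)\<close>; it cancels because it is
  nonzero.\<close>

lemma finite_field_power_card:
  fixes x :: "'k::{field,finite}"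
  shows "x ^ CARD('k) = x"
proof (cases "x = 0")
  case False
  have "x * (\<Prod>y\<in>UNIV-{0}. x * y) = x * x ^ (CARD('k) - 1) * \<Prod>(UNIV-{0})"
    by (simp add: prod.distrib mult_ac)
  also have "x * x ^ (CARD('k) - 1) = x ^ Suc (CARD('k) - 1)"
    by (subst power_Suc) auto
  also have "Suc (CARD('k) - 1) = CARD('k)"
    using finite_UNIV_card_ge_0[where ?'a = 'k] by simp
  also have "(\<Prod>y\<in>UNIV-{0}. x * y) = (\<Prod>y\<in>UNIV-{0}. y)"
    by (rule prod.reindex_bij_witness[of _ "\<lambda>y. y / x" "\<lambda>y. x * y"]) (use False in auto)
  finally show ?thesis
    by simp
qed (use finite_UNIV_card_ge_0[where ?'a = 'k] in auto)

lemma finite_field_card_gt_1: "CARD('k::{field,finite}) > 1"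
  using card_mono[of "UNIV :: 'k set" "{0,1}"] by simp

text \<open>The polynomial \<open>(X + 1) ^ q - X ^ q - 1\<close> has degree less than \<open>q\<close> and \<open>q\<close> roots.\<close>
lemma finite_field_binomial_eq_0:
  assumes "0 < j" "j < CARD('k::{field,finite})"
  shows "of_nat (CARD('k) choose j) = (0 :: 'k)"
proof -
  define q where "q = CARD('k)"
  define P :: "'k poly" where "P = (\<Sum>i\<in>{1..<q}. monom (of_nat (q choose i)) i)"
  have q1: "q > 1" unfolding q_def by (rule finite_field_card_gt_1)
  have "poly P x = 0" for x
  proof -
    have "(x + 1) ^ q = (\<Sum>i\<le>q. of_nat (q choose i) * x ^ i)"
      by (simp add: binomial_ring)
    also have "{..q} = insert 0 (insert q {1..<q})" using q1 by auto
    also have "(\<Sum>i\<in>\<dots>. of_nat (q choose i) * x ^ i) = 1 + x ^ q + poly P x"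
      using q1 by (simp add: P_def poly_sum poly_monom)
    finally show ?thesis
      by (simp add: q_def finite_field_power_card)
  qed
  have "P = 0"
  proof (rule ccontr)
    assume "P \<noteq> 0"
    then have "card {x. poly P x = 0} \<le> degree P" by (rule card_poly_roots_bound)
    also have "{x. poly P x = 0} = UNIV" using \<open>\<And>x. poly P x = 0\<close> by auto
    also have "degree P \<le> q - 1"
      unfolding P_def by (intro degree_sum_le) (auto intro: order.trans[OF degree_monom_le])
    finally show False using q1 by (simp add: q_def)
  qed
  then have "coeff P j = 0" by simp
  also have "coeff P j = of_nat (q choose j)"
    using assms by (simp add: P_def coeff_sum q_def)
  finally show ?thesis by (simp add: q_def)
qed

section \<open>The characteristic, and additivity of Frobenius\<close>

lemma finite_field_of_nat_card: "of_nat (CARD('k)) = (0 :: 'k::{field,finite})"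
  using finite_field_binomial_eq_0[of 1, where 'k='k] finite_field_card_gt_1[where 'k='k] by simp

lemma ac_of_nat_card: "of_nat (CARD('k)) = (0 :: 'k::{field,finite} alg_closure)"
  by (metis finite_field_of_nat_card to_ac_0 to_ac_of_nat)

lemma ac_power_card_add:
  fixes x y :: "'k::{field,finite} alg_closure"
  shows "(x + y) ^ CARD('k) = x ^ CARD('k) + y ^ CARD('k)"
proof -
  let ?q = "CARD('k)"
  have q1: "?q > 1" by (rule finite_field_card_gt_1)
  have "(x + y) ^ ?q = (\<Sum>i\<le>?q. of_nat (?q choose i) * x ^ i * y ^ (?q - i))"
    by (rule binomial_ring)
  also have "\<dots> = (\<Sum>i\<in>{0,?q}. of_nat (?q choose i) * x ^ i * y ^ (?q - i))"
  proof (intro sum.mono_neutral_right ballI)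
    fix i assume "i \<in> {..?q} - {0,?q}"
    then have "of_nat (?q choose i) = (0 :: 'k)"
      by (intro finite_field_binomial_eq_0) auto
    then have "of_nat (?q choose i) = (0 :: 'k alg_closure)"
      by (metis to_ac_0 to_ac_of_nat)
    then show "of_nat (?q choose i) * x ^ i * y ^ (?q - i) = 0" by simp
  qed auto
  finally show ?thesis using q1 by (simp add: add.commute)
qed

lemma ac_power_card_power_add:
  fixes x y :: "'k::{field,finite} alg_closure"
  shows "(x + y) ^ (CARD('k) ^ r) = x ^ (CARD('k) ^ r) + y ^ (CARD('k) ^ r)"
  by (induction r arbitrary: x y) (simp_all add: power_mult ac_power_card_add)

lemma ac_power_card_power_uminus:
  fixes x :: "'k::{field,finite} alg_closure"
  shows "(- x) ^ (CARD('k) ^ r) = - (x ^ (CARD('k) ^ r))"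
  using ac_power_card_power_add[of x "- x" r] finite_field_card_gt_1[where 'k='k]
  by (simp add: power_0_left eq_neg_iff_add_eq_0 add.commute)

lemma ac_power_card_power_diff:
  fixes x y :: "'k::{field,finite} alg_closure"
  shows "(x - y) ^ (CARD('k) ^ r) = x ^ (CARD('k) ^ r) - y ^ (CARD('k) ^ r)"
  using ac_power_card_power_add[of x "- y" r] ac_power_card_power_uminus[of y r] by simp

lemma ac_power_card_power_inj:
  fixes x y :: "'k::{field,finite} alg_closure"
  assumes "x ^ (CARD('k) ^ r) = y ^ (CARD('k) ^ r)"
  shows "x = y"
  using ac_power_card_power_diff[of x y r] assms by (simp add: power_0_left)

lemma ac_power_card_power_sum:
  fixes f :: "'b \<Rightarrow> 'k::{field,finite} alg_closure"
  shows "sum f A ^ (CARD('k) ^ r) = (\<Sum>i\<in>A. f i ^ (CARD('k) ^ r))"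
  by (induction A rule: infinite_finite_induct)
     (simp_all add: ac_power_card_power_add power_0_left)

section \<open>Root counts of separable polynomials\<close>

text \<open>Split off a root: if \<open>p = [:-x, 1:] * g\<close>, then the derivative of
  \<open>p\<close> equals \<open>poly g x\<close> at \<open>x\<close> and \<open>(y - x)\<close>
  times the derivative of \<open>g\<close> at a root \<open>y\<close> of \<open>g\<close>. Hence
  \<open>x\<close> is not a root of \<open>g\<close>, and \<open>g\<close> inherits the
  hypothesis.\<close>

lemma card_roots_eq_degree:
  fixes p :: "'a::alg_closed_field poly"
  assumes "p \<noteq> 0" "\<And>x. poly p x = 0 \<Longrightarrow> poly (pderiv p) x \<noteq> 0"
  shows "card {x. poly p x = 0} = degree p"
  using assms
proof (induction "degree p" arbitrary: p rule: less_induct)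
  case (less p)
  show ?case
  proof (cases "degree p = 0")
    case True
    then obtain c where "p = [:c:]" "c \<noteq> 0" using less.prems by (auto elim!: degree_eq_zeroE)
    then show ?thesis by simp
  next
    case False
    then obtain x where x: "poly p x = 0" using alg_closed_imp_poly_has_root by blast
    then obtain g where p: "p = [:-x, 1:] * g" by (metis poly_eq_0_iff_dvd dvdE)
    have g0: "g \<noteq> 0" using less.prems p by auto
    have deg: "degree p = Suc (degree g)" unfolding p using g0 by (subst degree_mult_eq) auto
    have der: "poly (pderiv p) y = poly g y + (y - x) * poly (pderiv g) y" for y
      unfolding p pderiv_mult by (simp add: pderiv_pCons algebra_simps)
    have "poly g x \<noteq> 0" using less.prems(2)[OF x] der[of x] by simp
    moreover have "poly (pderiv g) y \<noteq> 0" if "poly g y = 0" for y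
      using less.prems(2)[of y] der[of y] that by (auto simp: p)
    ultimately have "card {y. poly g y = 0} = degree g"
      using less.hyps[of g] g0 deg by auto
    moreover have "{y. poly p y = 0} = insert x {y. poly g y = 0}" by (auto simp: p)
    ultimately show ?thesis
      using \<open>poly g x \<noteq> 0\<close> g0 by (simp add: deg poly_roots_finite)
  qed
qed

lemma card_nth_roots_alg_closed:
  fixes c :: "'a::alg_closed_field"
  assumes "of_nat m \<noteq> (0 :: 'a)" "c \<noteq> 0"
  shows "card {x. x ^ m = c} = m"
proof -
  have m: "m > 0" using assms(1) by (intro Nat.gr0I) auto
  define p where "p = monom 1 m - [:c:]"
  have dp: "degree p = m" unfolding p_def using m
    by (subst diff_conv_add_uminus, subst degree_add_eq_left) (auto simp: degree_monom_eq)
  have ev: "poly p x = x ^ m - c" for x by (simp add: p_def poly_monom)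
  have "poly (pderiv p) x = of_nat m * x ^ (m - 1)" for x
    by (simp add: p_def pderiv_diff pderiv_monom poly_monom pderiv_pCons)
  moreover have "x \<noteq> 0" if "poly p x = 0" for x
    using that m assms(2) by (auto simp: ev power_0_left)
  ultimately have "card {x. poly p x = 0} = degree p"
    using dp m assms(1) by (intro card_roots_eq_degree) auto
  then show ?thesis by (simp add: dp ev)
qed

section \<open>The fixed fields of powers of Frobenius\<close>

text \<open>The polynomial \<open>X ^ Q - X\<close> has derivative -1, because \<open>Q\<close> is
  zero in this characteristic, so its \<open>Q\<close> roots are distinct.\<close>

lemma card_ext_field:
  assumes "r > 0"
  shows "card (ext_field r :: 'k::{field,finite} alg_closure set) = CARD('k) ^ r"
proof -
  define Q where "Q = CARD('k) ^ r"
  have Q1: "Q > 1" unfolding Q_def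
    using assms finite_field_card_gt_1[where 'k='k] by (metis one_less_power)
  have Q0: "of_nat Q = (0 :: 'k alg_closure)"
    unfolding Q_def of_nat_power ac_of_nat_card using assms by (simp add: power_0_left)
  define p :: "'k alg_closure poly" where "p = monom 1 Q - [:0, 1:]"
  have dp: "degree p = Q" unfolding p_def using Q1
    by (subst diff_conv_add_uminus, subst degree_add_eq_left) (auto simp: degree_monom_eq)
  have ev: "poly p x = x ^ Q - x" for x by (simp add: p_def poly_monom)
  have "poly (pderiv p) x = -1" for x
    by (simp add: p_def pderiv_diff pderiv_monom poly_monom pderiv_pCons Q0)
  then have "card {x. poly p x = 0} = degree p"
    using dp Q1 by (intro card_roots_eq_degree) auto
  then show ?thesis by (simp add: dp ev ext_field_def Q_def)
qed

lemma finite_ext_field: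
  assumes "r > 0"
  shows "finite (ext_field r :: 'k::{field,finite} alg_closure set)"
  using card_ext_field[OF assms, where 'k='k] finite_field_card_gt_1[where 'k='k]
  by (intro card_ge_0_finite) simp

lemma ext_field_0 [simp]: "0 \<in> (ext_field r :: 'k::{field,finite} alg_closure set)"
  and ext_field_1 [simp]: "1 \<in> (ext_field r :: 'k alg_closure set)"
  by (simp_all add: ext_field_def power_0_left)

lemma ext_field_add [intro]: "x \<in> ext_field r \<Longrightarrow> y \<in> ext_field r \<Longrightarrow> x + y \<in> ext_field r"
  by (simp add: ext_field_def ac_power_card_power_add)

lemma ext_field_uminus [intro]: "x \<in> ext_field r \<Longrightarrow> - x \<in> ext_field r"
  by (simp add: ext_field_def ac_power_card_power_uminus)

lemma ext_field_mult [intro]: "x \<in> ext_field r \<Longrightarrow> y \<in> ext_field r \<Longrightarrow> x * y \<in> ext_field r"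
  by (simp add: ext_field_def power_mult_distrib)

lemma ext_field_divide [intro]: "x \<in> ext_field r \<Longrightarrow> y \<in> ext_field r \<Longrightarrow> x / y \<in> ext_field r"
  by (simp add: ext_field_def power_divide)

lemma ext_field_power [intro]: "x \<in> ext_field r \<Longrightarrow> x ^ n \<in> ext_field r"
  by (simp add: ext_field_def power_mult[symmetric] mult.commute[of n])
     (simp add: power_mult)

lemma ext_field_sum [intro]: "(\<And>i. i \<in> A \<Longrightarrow> f i \<in> ext_field r) \<Longrightarrow> sum f A \<in> ext_field r"
  by (induction A rule: infinite_finite_induct) auto

lemma to_ac_in_ext_field [simp]: "to_ac c \<in> (ext_field r :: 'k::{field,finite} alg_closure set)"
proof -
  have "c ^ (CARD('k) ^ r) = c"
    by (induction r) (simp_all add: finite_field_power_card power_mult)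
  then show ?thesis by (simp add: ext_field_def flip: to_ac_power)
qed

lemma ext_field_1_eq: "ext_field 1 = range (to_ac :: 'k::{field,finite} \<Rightarrow> _)"
proof (rule sym, rule card_subset_eq)
  show "card (range (to_ac :: 'k \<Rightarrow> _)) = card (ext_field 1 :: 'k alg_closure set)"
    by (simp add: card_image[OF inj_to_ac] card_ext_field)
qed (auto intro: finite_ext_field)

lemma ext_field_power_iff:
  fixes x :: "'k::{field,finite} alg_closure"
  assumes "x \<noteq> 0"
  shows "x \<in> ext_field r \<longleftrightarrow> x ^ (CARD('k) ^ r - 1) = 1"
proof -
  have "x ^ (CARD('k) ^ r) = x * x ^ (CARD('k) ^ r - 1)"
    using finite_field_card_gt_1[where 'k='k] by (simp flip: power_Suc)
  then show ?thesis using assms by (simp add: ext_field_def)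
qed

subsection \<open>Newton's identity for monic polynomials\<close>

text \<open>Frobenius acting on coefficients. It is multiplicative and fixes exactly the polynomials
  over the base field, so membership in that subring can be tested by an equation.\<close>

definition frobenius_poly :: "'k::{field,finite} alg_closure poly \<Rightarrow> 'k alg_closure poly" where
  "frobenius_poly = map_poly (\<lambda>c. c ^ CARD('k))"

lemma coeff_frobenius_poly:
  fixes f :: "'k::{field,finite} alg_closure poly"
  shows "coeff (frobenius_poly f) i = coeff f i ^ CARD('k)"
  by (simp add: frobenius_poly_def coeff_map_poly power_0_left)

lemma ac_power_card_sum:
  fixes f :: "'b \<Rightarrow> 'k::{field,finite} alg_closure"
  shows "sum f A ^ CARD('k) = (\<Sum>i\<in>A. f i ^ CARD('k))"
  using ac_power_card_power_sum[of f A 1] by simp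

lemma frobenius_poly_mult: "frobenius_poly (f * g) = frobenius_poly f * frobenius_poly g"
  by (intro poly_eqI) (simp add: ac_power_card_sum coeff_frobenius_poly coeff_mult power_mult_distrib)

lemma frobenius_poly_1: "frobenius_poly 1 = 1"
  by (intro poly_eqI) (simp add: coeff_frobenius_poly one_pCons coeff_pCons power_0_left split: nat.splits)

lemma frobenius_poly_prod: "frobenius_poly (prod f A) = (\<Prod>i\<in>A. frobenius_poly (f i))"
  by (induction A rule: infinite_finite_induct)
     (simp_all add: frobenius_poly_mult frobenius_poly_1)

lemma frobenius_poly_linear:
  fixes x :: "'k::{field,finite} alg_closure"
  shows "frobenius_poly [:- x, 1:] = [:- (x ^ CARD('k)), 1:]"
  using ac_power_card_power_uminus[of x 1]
  by (intro poly_eqI) (simp add: coeff_frobenius_poly coeff_pCons power_0_left split: nat.splits)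

text \<open>Polynomials over the base field are kept as polynomials over the closure, where they can
  be compared directly with products of linear factors \<open>X - x\<close>.\<close>

definition monic_polys :: "nat \<Rightarrow> 'k::{field,finite} alg_closure poly set" where
  "monic_polys n = {f. degree f = n \<and> lead_coeff f = 1 \<and> (\<forall>i. coeff f i \<in> ext_field 1)}"

lemma frobenius_poly_fixed_iff:
  "frobenius_poly f = f \<longleftrightarrow> (\<forall>i. coeff f i \<in> ext_field 1)"
  by (simp add: poly_eq_iff coeff_frobenius_poly ext_field_def)

lemma monic_polysI:
  "degree f = n \<Longrightarrow> lead_coeff f = 1 \<Longrightarrow> frobenius_poly f = f \<Longrightarrow> f \<in> monic_polys n"
  by (simp add: monic_polys_def frobenius_poly_fixed_iff)

lemma monic_polysD:
  assumes "f \<in> monic_polys n"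
  shows "degree f = n" "lead_coeff f = 1" "frobenius_poly f = f" "f \<noteq> 0"
    "coeff f i \<in> ext_field 1"
proof -
  show "f \<noteq> 0" using assms by (auto simp: monic_polys_def)
qed (use assms in \<open>auto simp: monic_polys_def frobenius_poly_fixed_iff\<close>)

lemma finite_monic_polys: "finite (monic_polys n :: 'k::{field,finite} alg_closure poly set)"
proof (rule finite_subset)
  let ?F = "ext_field 1 :: 'k alg_closure set"
  show "monic_polys n \<subseteq> Poly ` {xs. set xs \<subseteq> ?F \<and> length xs = Suc n}"
  proof
    fix f :: "'k alg_closure poly" assume f: "f \<in> monic_polys n"
    have "set (coeffs f) \<subseteq> ?F"
      using monic_polysD(5)[OF f] by (auto simp: coeffs_def)
    moreover have "length (coeffs f) = Suc n"
      using monic_polysD(1,4)[OF f] by (simp add: length_coeffs_degree)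
    ultimately show "f \<in> Poly ` {xs. set xs \<subseteq> ?F \<and> length xs = Suc n}"
      by (intro image_eqI[of _ _ "coeffs f"]) auto
  qed
  show "finite (Poly ` {xs. set xs \<subseteq> ?F \<and> length xs = Suc n})"
    by (intro finite_imageI finite_lists_length_eq finite_ext_field) auto
qed

lemma monic_polys_mult:
  assumes "f \<in> monic_polys a" "g \<in> monic_polys b"
  shows "f * g \<in> monic_polys (a + b)"
proof (rule monic_polysI)
  note f = monic_polysD[OF assms(1)] and g = monic_polysD[OF assms(2)]
  show "degree (f * g) = a + b" using f g by (simp add: degree_mult_eq)
  show "lead_coeff (f * g) = 1" using f(2) g(2) by (simp only: lead_coeff_mult mult_1)
  show "frobenius_poly (f * g) = f * g" using f(3) g(3) by (simp add: frobenius_poly_mult)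
qed

text \<open>The quotient descends to the base field: Frobenius fixes both \<open>h * g\<close> and
  \<open>h\<close>, so \<open>h * frobenius_poly g = h * g\<close>, and \<open>h\<close>
  cancels.\<close>

lemma monic_polys_cancel:
  assumes "h * g \<in> monic_polys n" "h \<in> monic_polys r"
  shows "r \<le> n" "g \<in> monic_polys (n - r)"
proof -
  have nz: "h \<noteq> 0" "g \<noteq> 0" using monic_polysD(4)[OF assms(1)] by auto
  have deg: "degree h + degree g = n"
    using monic_polysD(1)[OF assms(1)] nz by (simp add: degree_mult_eq)
  then show "r \<le> n" using monic_polysD(1)[OF assms(2)] by simp
  show "g \<in> monic_polys (n - r)"
  proof (rule monic_polysI)
    show "degree g = n - r" using deg monic_polysD(1)[OF assms(2)] by simp
    have "lead_coeff h * lead_coeff g = 1"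
      using monic_polysD(2)[OF assms(1)] by (simp only: lead_coeff_mult)
    then show "lead_coeff g = 1" using monic_polysD(2)[OF assms(2)] by simp
    have "h * frobenius_poly g = h * g"
      using monic_polysD(3)[OF assms(1)] monic_polysD(3)[OF assms(2)]
      by (simp add: frobenius_poly_mult)
    then show "frobenius_poly g = g" using nz by simp
  qed
qed

lemma monic_polys_0: "monic_polys 0 = {1 :: 'k::{field,finite} alg_closure poly}"
proof -
  have "f = 1" if "f \<in> monic_polys 0" for f :: "'k alg_closure poly"
    using monic_polysD(1,2)[OF that] by (auto elim!: degree_eq_zeroE simp: one_pCons)
  moreover have "1 \<in> (monic_polys 0 :: 'k alg_closure poly set)"
    by (intro monic_polysI) (auto simp: frobenius_poly_1)
  ultimately show ?thesis by auto
qed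

lemma monic_polys_root_power:
  fixes f :: "'k::{field,finite} alg_closure poly"
  assumes "f \<in> monic_polys n" "poly f x = 0"
  shows "poly f (x ^ (CARD('k) ^ i)) = 0"
proof (induction i)
  case (Suc i)
  let ?y = "x ^ (CARD('k) ^ i)"
  have c: "coeff f j ^ CARD('k) = coeff f j" for j
    using monic_polysD(5)[OF assms(1), of j] by (simp add: ext_field_def)
  have "0 = poly f ?y ^ CARD('k)" using Suc by (simp add: power_0_left)
  also have "\<dots> = (\<Sum>j\<le>degree f. (coeff f j * ?y ^ j) ^ CARD('k))"
    by (simp add: poly_altdef ac_power_card_sum)
  also have "\<dots> = (\<Sum>j\<le>degree f. coeff f j * (x ^ (CARD('k) ^ Suc i)) ^ j)"
    by (simp add: power_mult_distrib c mult_ac flip: power_mult)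
  finally show ?case by (simp add: poly_altdef)
qed (use assms in auto)

section \<open>Orbit polynomials and their divisibility\<close>

text \<open>For \<open>x\<close> in the extension of degree \<open>r\<close> this is the
  characteristic polynomial of \<open>x\<close> over the base field, a power of the minimal
  polynomial. An element of a smaller field therefore has repeated factors here.\<close>

definition orbit_poly :: "nat \<Rightarrow> 'k::{field,finite} alg_closure \<Rightarrow> 'k alg_closure poly" where
  "orbit_poly r x = (\<Prod>i<r. [:- (x ^ (CARD('k) ^ i)), 1:])"

lemma degree_orbit_poly: "degree (orbit_poly r x) = r"
  unfolding orbit_poly_def by (subst degree_prod_sum_eq) auto

lemma orbit_poly_monic_polys:
  fixes x :: "'k::{field,finite} alg_closure"
  assumes "x \<in> ext_field r"
  shows "orbit_poly r x \<in> monic_polys r"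
proof (rule monic_polysI[OF degree_orbit_poly])
  let ?h = "\<lambda>i. [:- (x ^ (CARD('k) ^ i)), 1:]"
  show "lead_coeff (orbit_poly r x) = 1"
    unfolding orbit_poly_def by (subst lead_coeff_prod) auto
  \<comment> \<open>Frobenius moves factor \<open>i\<close> to factor \<open>i + 1\<close>. Since
    \<open>x\<close> is fixed by the \<open>r\<close>-th power of Frobenius, factor \<open>r\<close>
    is factor 0 again, and the shifted product equals the original one.\<close>
  have "?h 0 * (\<Prod>i<r. ?h (Suc i)) = (\<Prod>i<r. ?h i) * ?h r"
    using prod.lessThan_Suc_shift[of ?h r] prod.lessThan_Suc[of ?h r] by (simp only:)
  also have "?h r = ?h 0" using assms by (simp add: ext_field_def)
  also have "(\<Prod>i<r. ?h i) * ?h 0 = ?h 0 * (\<Prod>i<r. ?h i)" by (rule mult.commute)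
  finally have "(\<Prod>i<r. ?h (Suc i)) = (\<Prod>i<r. ?h i)"
    by (rule mult_left_cancel[THEN iffD1, rotated]) simp
  then show "frobenius_poly (orbit_poly r x) = orbit_poly r x"
    by (simp add: orbit_poly_def frobenius_poly_prod frobenius_poly_linear mult.commute
        flip: power_mult)
qed

text \<open>The conjugates with indices \<open>r\<close> to \<open>r + s - 1\<close> repeat those
  with indices 0 to \<open>s - 1\<close>.\<close>

lemma orbit_poly_add:
  fixes x :: "'k::{field,finite} alg_closure"
  assumes "x \<in> ext_field r"
  shows "orbit_poly (r + s) x = orbit_poly r x * orbit_poly s x"
proof (induction s)
  case (Suc s)
  have "x ^ (CARD('k) ^ (r + s)) = x ^ (CARD('k) ^ s)"
    using assms by (simp add: ext_field_def power_add power_mult)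
  then show ?case using Suc by (simp add: orbit_poly_def mult_ac del: mult_pCons_left mult_pCons_right)
qed (simp add: orbit_poly_def)

text \<open>Frobenius is injective, so its \<open>i\<close>-th power can be cancelled from both
  sides.\<close>

lemma ext_field_of_power_eq:
  fixes x :: "'k::{field,finite} alg_closure"
  assumes "x ^ (CARD('k) ^ i) = x ^ (CARD('k) ^ j)" "i < j"
  shows "x \<in> ext_field (j - i)"
proof -
  have "j = (j - i) + i" using assms(2) by simp
  then have "CARD('k) ^ j = CARD('k) ^ (j - i) * CARD('k) ^ i" by (metis power_add)
  then have "x ^ (CARD('k) ^ i) = (x ^ (CARD('k) ^ (j - i))) ^ (CARD('k) ^ i)"
    using assms(1) by (simp add: power_mult)
  then show ?thesis
    using ac_power_card_power_inj[of x i "x ^ (CARD('k) ^ (j - i))"] by (simp add: ext_field_def)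
qed

lemma ext_field_diff_degree:
  fixes x :: "'k::{field,finite} alg_closure"
  assumes "x \<in> ext_field r" "x \<in> ext_field s" "r < s"
  shows "x \<in> ext_field (s - r)"
  using assms by (intro ext_field_of_power_eq) (auto simp: ext_field_def)

lemma prod_linear_dvd:
  fixes f :: "'a::field poly"
  assumes "finite A" "\<And>x. x \<in> A \<Longrightarrow> poly f x = 0"
  shows "(\<Prod>x\<in>A. [:- x, 1:]) dvd f"
  using assms
proof (induction A arbitrary: f rule: finite_induct)
  case (insert a A)
  obtain g where g: "f = [:- a, 1:] * g"
    using insert.prems[of a] by (metis insertI1 poly_eq_0_iff_dvd dvdE)
  have "poly g x = 0" if "x \<in> A" for x
    using insert.prems[of x] that insert.hyps by (auto simp: g)
  then have "(\<Prod>x\<in>A. [:- x, 1:]) dvd g" by (rule insert.IH)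
  then show ?case using insert.hyps by (simp add: g mult_dvd_mono del: mult_pCons_left)
qed simp

text \<open>Induction by splitting off a linear factor. The index set may exceed the set of roots,
  since other points have order zero; this allows one common index set later on.\<close>

lemma sum_order_eq_degree:
  fixes p :: "'a::alg_closed_field poly"
  assumes "p \<noteq> 0" "finite A" "\<And>x. poly p x = 0 \<Longrightarrow> x \<in> A"
  shows "(\<Sum>x\<in>A. Polynomial.order x p) = degree p"
  using assms
proof (induction "degree p" arbitrary: p rule: less_induct)
  case (less p)
  show ?case
  proof (cases "degree p = 0")
    case True
    then obtain c where "p = [:c:]" "c \<noteq> 0" using less.prems by (auto elim!: degree_eq_zeroE)
    then show ?thesis by (simp add: order_0I)
  next
    case False
    then obtain x where x: "poly p x = 0" using alg_closed_imp_poly_has_root by blast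
    then obtain g where p: "p = [:-x, 1:] * g" by (metis poly_eq_0_iff_dvd dvdE)
    have g0: "g \<noteq> 0" using less.prems p by auto
    have deg: "degree p = Suc (degree g)" unfolding p using g0 by (subst degree_mult_eq) auto
    have "Polynomial.order y [:-x, 1:] = (if y = x then 1 else 0)" for y
      using order_power_n_n[of x 1] by (auto intro: order_0I)
    then have ord: "Polynomial.order y p = (if y = x then 1 else 0) + Polynomial.order y g" for y
      using less.prems(1) unfolding p by (subst order_mult) auto
    have "(\<Sum>y\<in>A. Polynomial.order y g) = degree g"
      using less.prems by (intro less.hyps) (auto simp: deg g0, simp add: p)
    then show ?thesis using less.prems(2,3) x by (simp add: ord sum.distrib deg)
  qed
qed

text \<open>If \<open>\<delta>\<close> is the period of \<open>x\<close> under Frobenius and \<open>f = orbit_poly \<delta> x * g\<close>, then removing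
  the factor \<open>orbit_poly \<delta> x\<close> lowers both sides by one.\<close>
lemma card_orbit_poly_dvd:
  fixes f :: "'k::{field,finite} alg_closure poly"
  assumes "f \<in> monic_polys n"
  shows "card {r. r > 0 \<and> x \<in> ext_field r \<and> orbit_poly r x dvd f} = Polynomial.order x f"
  using assms
proof (induction n arbitrary: f rule: less_induct)
  case (less n)
  define D where "D = (\<lambda>f. {r. r > 0 \<and> x \<in> ext_field r \<and> orbit_poly r x dvd f})"
  have finD: "finite (D h)" if "h \<noteq> 0" for h
  proof (rule finite_subset)
    show "D h \<subseteq> {..degree h}"
      using dvd_imp_degree_le[OF _ that] by (auto simp: D_def degree_orbit_poly dest!: spec)
         (metis degree_orbit_poly dvd_imp_degree_le that)
  qed auto
  have f0: "f \<noteq> 0" using monic_polysD(4)[OF less.prems] .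
  show ?case
  proof (cases "poly f x = 0")
    case False
    have "\<not> orbit_poly r x dvd f" if "r > 0" for r
    proof
      assume "orbit_poly r x dvd f"
      moreover have "[:- x, 1:] dvd orbit_poly r x"
        unfolding orbit_poly_def using that dvd_prodI[of "{..<r}" 0 "\<lambda>i. [:- (x ^ (CARD('k) ^ i)), 1:]"]
        by simp
      ultimately show False using False by (metis dvd_trans poly_eq_0_iff_dvd)
    qed
    then have "{r. r > 0 \<and> x \<in> ext_field r \<and> orbit_poly r x dvd f} = {}" by auto
    then show ?thesis using order_0I[OF False] by (simp only: card.empty)
  next
    case True
    have "\<exists>r>0. x \<in> ext_field r"
    proof -
      \<comment> \<open>All conjugates of \<open>x\<close> are roots of \<open>f\<close>, and
        \<open>f\<close> has at most \<open>n\<close> of them, so among \<open>n + 1\<close>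
        conjugates two coincide. This gives \<open>x\<close> a Frobenius period.\<close>
      have "\<not> inj_on (\<lambda>i. x ^ (CARD('k) ^ i)) {..n}"
      proof
        assume "inj_on (\<lambda>i. x ^ (CARD('k) ^ i)) {..n}"
        then have "Suc n = card ((\<lambda>i. x ^ (CARD('k) ^ i)) ` {..n})" by (simp add: card_image)
        also have "\<dots> \<le> card {y. poly f y = 0}"
          using monic_polys_root_power[OF less.prems True] f0
          by (intro card_mono) (auto simp: poly_roots_finite)
        also have "\<dots> \<le> n" using card_poly_roots_bound[OF f0] monic_polysD(1)[OF less.prems] by simp
        finally show False by simp
      qed
      then obtain i j where "i \<noteq> j" "x ^ (CARD('k) ^ i) = x ^ (CARD('k) ^ j)"
        by (auto simp: inj_on_def)
      then show ?thesis
        using ext_field_of_power_eq[of x i j] ext_field_of_power_eq[of x j i]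
        by (metis linorder_neqE_nat zero_less_diff)
    qed
    define \<delta> where "\<delta> = (LEAST r. r > 0 \<and> x \<in> ext_field r)"
    have \<delta>: "\<delta> > 0" "x \<in> ext_field \<delta>"
      using LeastI_ex[OF \<open>\<exists>r>0. x \<in> ext_field r\<close>] by (auto simp: \<delta>_def)
    have min: "\<delta> \<le> r" if "r > 0" "x \<in> ext_field r" for r
      using that unfolding \<delta>_def by (intro Least_le) auto
    have inj: "inj_on (\<lambda>i. x ^ (CARD('k) ^ i)) {..<\<delta>}"
    proof (rule linorder_inj_onI')
      fix i j assume "i \<in> {..<\<delta>}" "j \<in> {..<\<delta>}" "i < j"
      then show "x ^ (CARD('k) ^ i) \<noteq> x ^ (CARD('k) ^ j)"
        using ext_field_of_power_eq[of x i j] min[of "j - i"] by fastforce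
    qed
    have "orbit_poly \<delta> x = (\<Prod>y\<in>(\<lambda>i. x ^ (CARD('k) ^ i)) ` {..<\<delta>}. [:- y, 1:])"
      by (simp add: orbit_poly_def prod.reindex[OF inj])
    also have "\<dots> dvd f"
      using monic_polys_root_power[OF less.prems True] by (intro prod_linear_dvd) auto
    finally obtain g where g: "f = orbit_poly \<delta> x * g" by (elim dvdE)
    have om: "orbit_poly \<delta> x \<in> monic_polys \<delta>" by (rule orbit_poly_monic_polys[OF \<delta>(2)])
    note gm = monic_polys_cancel[OF less.prems[unfolded g] om]
    have g0: "g \<noteq> 0" using f0 g by auto
    have "card (D g) = Polynomial.order x g"
      unfolding D_def using \<delta>(1) gm by (intro less.IH[OF _ gm(2)]) auto
    \<comment> \<open>No element of \<open>D f\<close> is below the period. An element above it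
      yields an element of \<open>D g\<close> by subtracting the period and cancelling one factor
      \<open>orbit_poly \<delta> x\<close>, and conversely.\<close>
    moreover have "D f = insert \<delta> ((+) \<delta> ` D g)"
    proof (intro Set.set_eqI iffI)
      fix r assume r: "r \<in> D f"
      show "r \<in> insert \<delta> ((+) \<delta> ` D g)"
      proof (cases "r = \<delta>")
        case False
        with r min[of r] have r': "\<delta> < r" by (auto simp: D_def)
        have e: "x \<in> ext_field (r - \<delta>)"
          using r r' \<delta> by (intro ext_field_diff_degree) (auto simp: D_def)
        have "orbit_poly \<delta> x * orbit_poly (r - \<delta>) x = orbit_poly r x"
          using r' by (simp flip: orbit_poly_add[OF \<delta>(2)])
        then have "orbit_poly \<delta> x * orbit_poly (r - \<delta>) x dvd orbit_poly \<delta> x * g"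
          using r g by (simp add: D_def)
        then have "r - \<delta> \<in> D g" using e r' monic_polysD(4)[OF om] by (simp add: D_def)
        then show ?thesis using r' by (auto intro!: image_eqI[of _ _ "r - \<delta>"])
      qed simp
    next
      fix r assume "r \<in> insert \<delta> ((+) \<delta> ` D g)"
      then show "r \<in> D f"
      proof
        assume "r \<in> (+) \<delta> ` D g"
        then obtain s where s: "r = \<delta> + s" "s \<in> D g" by auto
        have "x \<in> ext_field (\<delta> + s)" using s \<delta> by (auto simp: D_def ext_field_def power_add power_mult)
        moreover have "orbit_poly (\<delta> + s) x dvd f"
          using s by (simp add: orbit_poly_add[OF \<delta>(2)] g D_def)
        ultimately show ?thesis using s \<delta> by (simp add: D_def)
      qed (use \<delta> g in \<open>simp add: D_def\<close>)
    qed
    moreover have "\<delta> \<notin> (+) \<delta> ` D g" by (auto simp: D_def)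
    ultimately have "card (D f) = Suc (Polynomial.order x g)"
      using finD[OF g0] by (simp add: card_image)
    moreover have "Polynomial.order x (orbit_poly \<delta> x) = 1"
    proof -
      obtain e where e: "\<delta> = Suc e" using \<delta>(1) gr0_conv_Suc by blast
      let ?h = "\<Prod>i<e. [:- (x ^ (CARD('k) ^ Suc i)), 1:]"
      have o: "orbit_poly \<delta> x = [:- x, 1:] * ?h"
        unfolding orbit_poly_def e prod.lessThan_Suc_shift by simp
      have "x \<noteq> x ^ (CARD('k) ^ Suc i)" if "i < e" for i
        using inj_onD[OF inj, of 0 "Suc i"] that e by auto
      then have "poly ?h x \<noteq> 0" by (auto simp: poly_prod simp del: power_Suc)
      then show ?thesis
        using order_power_n_n[of x 1] monic_polysD(4)[OF om] unfolding o
        by (subst order_mult) (auto simp: order_0I)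
    qed
    ultimately show ?thesis
      using f0 unfolding g by (subst order_mult) (auto simp: D_def)
  qed
qed

text \<open>For fixed \<open>x\<close> the admissible \<open>r\<close> are as many as the
  multiplicity of \<open>x\<close> as a root of \<open>f\<close>, and the multiplicities add up to
  the degree.\<close>

lemma sum_orbit_poly_dvd:
  fixes f :: "'k::{field,finite} alg_closure poly"
  assumes "f \<in> monic_polys n"
  shows "(\<Sum>r\<in>{1..n}. \<Sum>x\<in>ext_field r. of_bool (orbit_poly r x dvd f)) = (of_nat n :: complex)"
proof -
  have f0: "f \<noteq> 0" and deg: "degree f = n" using monic_polysD[OF assms] by auto
  \<comment> \<open>A finite set containing all roots and all extensions involved, so that the sums
    over \<open>r\<close> and \<open>x\<close> can be exchanged.\<close>
  define A where "A = {x. poly f x = 0} \<union> (\<Union>r\<in>{1..n}. ext_field r)"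
  have finA: "finite A"
    unfolding A_def using f0 by (auto intro!: finite_ext_field simp: poly_roots_finite)
  have "(\<Sum>r\<in>{1..n}. \<Sum>x\<in>ext_field r. of_bool (orbit_poly r x dvd f)) =
        (\<Sum>r\<in>{1..n}. \<Sum>x\<in>A. of_bool (x \<in> ext_field r \<and> orbit_poly r x dvd f) :: complex)"
    by (intro sum.cong refl sum.mono_neutral_cong_left finA) (auto simp: A_def)
  also have "\<dots> = (\<Sum>x\<in>A. \<Sum>r\<in>{1..n}. of_bool (x \<in> ext_field r \<and> orbit_poly r x dvd f))"
    by (rule sum.swap)
  also have "\<dots> = (\<Sum>x\<in>A. of_nat (Polynomial.order x f))"
  proof (intro sum.cong refl)
    fix x
    \<comment> \<open>The bound \<open>r \<le> n\<close> loses nothing: a divisor of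
      \<open>f\<close> has degree at most \<open>n\<close>.\<close>
    have "{1..n} \<inter> {r. x \<in> ext_field r \<and> orbit_poly r x dvd f} =
          {r. r > 0 \<and> x \<in> ext_field r \<and> orbit_poly r x dvd f}"
      using dvd_imp_degree_le[OF _ f0] deg by (auto simp: Suc_le_eq) (metis degree_orbit_poly)
    then show "(\<Sum>r\<in>{1..n}. of_bool (x \<in> ext_field r \<and> orbit_poly r x dvd f))
        = (of_nat (Polynomial.order x f) :: complex)"
      by (simp add: card_orbit_poly_dvd[OF assms] del: of_bool_conj)
  qed
  also have "\<dots> = of_nat (\<Sum>x\<in>A. Polynomial.order x f)" by simp
  also have "(\<Sum>x\<in>A. Polynomial.order x f) = n"
    using sum_order_eq_degree[OF f0 finA] deg by (simp add: A_def)
  finally show ?thesis .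
qed

text \<open>Write the factor \<open>n\<close> as the number of pairs \<open>r\<close>,
  \<open>x\<close> with \<open>orbit_poly r x dvd f\<close>, exchange the sums, and split
  \<open>\<Lambda> f\<close> along the cofactor, which ranges over
  \<open>monic_polys (n - r)\<close>. In generating functions this is the logarithmic derivative of
  the series with coefficients \<open>\<Sum>f\<in>monic_polys n. \<Lambda> f\<close>.\<close>

lemma newton_identity:
  fixes \<Lambda> :: "'k::{field,finite} alg_closure poly \<Rightarrow> complex"
  assumes mult: "\<And>a b f g. f \<in> monic_polys a \<Longrightarrow> g \<in> monic_polys b \<Longrightarrow> \<Lambda> (f * g) = \<Lambda> f * \<Lambda> g"
  shows "of_nat n * (\<Sum>f\<in>monic_polys n. \<Lambda> f) =
    (\<Sum>r\<in>{1..n}. (\<Sum>x\<in>ext_field r. \<Lambda> (orbit_poly r x)) * (\<Sum>f\<in>monic_polys (n - r). \<Lambda> f))"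
proof -
  have "of_nat n * (\<Sum>f\<in>monic_polys n. \<Lambda> f) =
    (\<Sum>f\<in>monic_polys n. \<Sum>r\<in>{1..n}. \<Sum>x\<in>ext_field r. of_bool (orbit_poly r x dvd f) * \<Lambda> f)"
    unfolding sum_distrib_left
    by (intro sum.cong refl) (simp only: sum_orbit_poly_dvd flip: sum_distrib_right)
  also have "\<dots> = (\<Sum>r\<in>{1..n}. \<Sum>x\<in>ext_field r. \<Sum>f\<in>monic_polys n. of_bool (orbit_poly r x dvd f) * \<Lambda> f)"
    by (subst sum.swap, rule sum.cong[OF refl], rule sum.swap)
  also have "\<dots> = (\<Sum>r\<in>{1..n}. \<Sum>x\<in>ext_field r.
      \<Sum>f\<in>monic_polys (n - r). \<Lambda> (orbit_poly r x) * \<Lambda> f)"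
  proof (rule sum.cong[OF refl], rule sum.cong[OF refl])
    fix r and x :: "'k alg_closure" assume r: "r \<in> {1..n}" and x: "x \<in> ext_field r"
    note om = orbit_poly_monic_polys[OF x]
    have inj: "inj_on ((*) (orbit_poly r x)) (monic_polys (n - r))"
      using monic_polysD(4)[OF om] by (auto simp: inj_on_def)
    have "(\<Sum>f\<in>monic_polys n. of_bool (orbit_poly r x dvd f) * \<Lambda> f) =
          (\<Sum>f\<in>(*) (orbit_poly r x) ` monic_polys (n - r). \<Lambda> f)"
    proof (intro sum.mono_neutral_cong_right finite_monic_polys ballI)
      show "(*) (orbit_poly r x) ` monic_polys (n - r) \<subseteq> monic_polys n"
        using monic_polys_mult[OF om, of _ "n - r"] r by auto
      fix f assume f: "f \<in> monic_polys n - (*) (orbit_poly r x) ` monic_polys (n - r)"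
      have "\<not> orbit_poly r x dvd f"
      proof
        assume "orbit_poly r x dvd f"
        then obtain g where g: "f = orbit_poly r x * g" by (elim dvdE)
        then have "g \<in> monic_polys (n - r)" using f om by (intro monic_polys_cancel(2)) auto
        then show False using f g by auto
      qed
      then show "of_bool (orbit_poly r x dvd f) * \<Lambda> f = 0" by simp
    qed auto
    also have "\<dots> = (\<Sum>f\<in>monic_polys (n - r). \<Lambda> (orbit_poly r x) * \<Lambda> f)"
      by (simp add: sum.reindex[OF inj] mult[OF om])
    finally show "(\<Sum>f\<in>monic_polys n. of_bool (orbit_poly r x dvd f) * \<Lambda> f) =
        (\<Sum>f\<in>monic_polys (n - r). \<Lambda> (orbit_poly r x) * \<Lambda> f)" .
  qed
  also have "\<dots> = (\<Sum>r\<in>{1..n}. (\<Sum>x\<in>ext_field r. \<Lambda> (orbit_poly r x)) * (\<Sum>f\<in>monic_polys (n - r). \<Lambda> f))"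
    by (simp only: sum_distrib_left[symmetric] sum_distrib_right[symmetric])
  finally show ?thesis .
qed

subsection \<open>The Hasse-Davenport relation\<close>

definition ext_norm :: "nat \<Rightarrow> 'k::{field,finite} alg_closure \<Rightarrow> 'k alg_closure" where
  "ext_norm r x = (\<Prod>i<r. x ^ (CARD('k) ^ i))"

definition ext_trace :: "nat \<Rightarrow> 'k::{field,finite} alg_closure \<Rightarrow> 'k alg_closure" where
  "ext_trace r x = (\<Sum>i<r. x ^ (CARD('k) ^ i))"

lemma coeff_0_orbit_poly: "coeff (orbit_poly r x) 0 = (-1) ^ r * ext_norm r x"
proof -
  have "poly (orbit_poly r x) 0 = (\<Prod>i<r. (-1) * x ^ (CARD('a) ^ i))"
    by (simp add: orbit_poly_def poly_prod)
  also have "\<dots> = (-1) ^ r * ext_norm r x"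
    by (simp only: prod.distrib ext_norm_def) simp
  finally show ?thesis by (simp add: poly_0_coeff_0)
qed

text \<open>The reverse of a monic polynomial has constant term 1, so passing to reverses makes the
  second highest coefficient additive under products; this is how traces add.\<close>

lemma coeff_1_mult_normalized:
  assumes "coeff f 0 = 1" "coeff g 0 = (1 :: 'a::comm_semiring_1)"
  shows "coeff (f * g) 1 = coeff f 1 + coeff g 1"
  using assms by (simp add: coeff_mult add.commute)

lemma coeff_1_reflect_orbit_poly: "coeff (reflect_poly (orbit_poly r x)) 1 = - ext_trace r x"
proof (induction r)
  case (Suc r)
  let ?y = "x ^ (CARD('a) ^ r)"
  have lc: "lead_coeff (orbit_poly r x) = 1"
    unfolding orbit_poly_def by (subst lead_coeff_prod) auto
  have "orbit_poly (Suc r) x = orbit_poly r x * [:- ?y, 1:]"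
    by (simp add: orbit_poly_def del: mult_pCons_right)
  then have "coeff (reflect_poly (orbit_poly (Suc r) x)) 1
      = coeff (reflect_poly (orbit_poly r x)) 1 + coeff (reflect_poly [:- ?y, 1:]) 1"
    using lc by (simp only: reflect_poly_mult, intro coeff_1_mult_normalized) simp_all
  also have "coeff (reflect_poly [:- ?y, 1:]) 1 = - ?y"
    by (simp add: coeff_reflect_poly)
  finally show ?case using Suc by (simp add: ext_trace_def)
qed (simp_all add: orbit_poly_def ext_trace_def)

lemma ext_norm_in_range:
  assumes "x \<in> ext_field r"
  shows "ext_norm r x \<in> range to_ac"
proof -
  have "(-1) ^ r * coeff (orbit_poly r x) 0 \<in> ext_field 1"
    using monic_polysD(5)[OF orbit_poly_monic_polys[OF assms]] by (intro ext_field_mult ext_field_power) auto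
  then show ?thesis
    by (simp add: coeff_0_orbit_poly ext_field_1_eq[symmetric] flip: mult.assoc power_mult_distrib)
qed

lemma ext_trace_in_range:
  assumes "x \<in> ext_field r"
  shows "ext_trace r x \<in> range to_ac"
proof -
  have "coeff (reflect_poly (orbit_poly r x)) 1 \<in> ext_field 1"
    using monic_polysD(5)[OF orbit_poly_monic_polys[OF assms]]
    by (simp add: coeff_reflect_poly del: One_nat_def)
  then have "- (- ext_trace r x) \<in> ext_field 1"
    unfolding coeff_1_reflect_orbit_poly by (rule ext_field_uminus)
  then show ?thesis by (simp add: ext_field_1_eq[symmetric])
qed

text \<open>\<open>of_ac\<close> inverts \<open>to_ac\<close> on the range of the latter, so norms,
  traces and coefficients must be shown to lie there before they are fed to characters of the base
  field.\<close>

lemma of_ac_mult: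
  "x \<in> range to_ac \<Longrightarrow> y \<in> range to_ac \<Longrightarrow> of_ac (x * y) = of_ac x * of_ac y"
  by (auto simp flip: to_ac_mult)

lemma of_ac_add:
  "x \<in> range to_ac \<Longrightarrow> y \<in> range to_ac \<Longrightarrow> of_ac (x + y) = of_ac x + of_ac y"
  by (auto simp flip: to_ac_add)

lemma mult_charD:
  assumes "mult_char \<chi>"
  shows "\<chi> 0 = 0" "\<chi> 1 = 1" "\<chi> (x * y) = \<chi> x * \<chi> y"
  using assms by (auto simp: mult_char_def)

lemma nontrivial_add_charD:
  assumes "nontrivial_add_char \<psi>"
  shows "\<psi> 0 = 1" "\<psi> (x + y) = \<psi> x * \<psi> y"
  using assms by (auto simp: nontrivial_add_char_def)

text \<open>For \<open>f = X ^ n - c\<^sub>1 X ^ (n - 1) + \<dots> + (-1) ^ n c\<^sub>n\<close> this is \<open>\<chi> c\<^sub>n * \<psi> c\<^sub>1\<close>; reading \<open>c\<^sub>1\<close>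
  from the reflected polynomial gives \<open>c\<^sub>1 = 0\<close> when \<open>n = 0\<close>.\<close>
definition gauss_weight ::
    "('k::{field,finite} \<Rightarrow> complex) \<Rightarrow> ('k \<Rightarrow> complex) \<Rightarrow> 'k alg_closure poly \<Rightarrow> complex" where
  "gauss_weight \<psi> \<chi> f =
     \<chi> (of_ac ((-1) ^ degree f * coeff f 0)) * \<psi> (of_ac (- coeff (reflect_poly f) 1))"

lemma monic_polys_coeffs_in_range:
  assumes "f \<in> monic_polys n"
  shows "(-1) ^ degree f * coeff f 0 \<in> range to_ac" "- coeff (reflect_poly f) 1 \<in> range to_ac"
proof -
  note c = monic_polysD(5)[OF assms]
  have "(-1) ^ degree f * coeff f 0 \<in> ext_field 1"
    using c by (intro ext_field_mult ext_field_power) auto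
  then show "(-1) ^ degree f * coeff f 0 \<in> range to_ac" by (simp add: ext_field_1_eq[symmetric])
  have "- coeff (reflect_poly f) 1 \<in> ext_field 1"
    using c by (intro ext_field_uminus) (simp add: coeff_reflect_poly del: One_nat_def)
  then show "- coeff (reflect_poly f) 1 \<in> range to_ac" by (simp add: ext_field_1_eq[symmetric])
qed

lemma coeff_monic_polys: "f \<in> monic_polys n \<Longrightarrow> coeff f n = 1"
  by (auto simp: monic_polys_def)

lemma gauss_weight_mult:
  assumes \<chi>: "mult_char \<chi>" and \<psi>: "nontrivial_add_char \<psi>"
    and f: "f \<in> monic_polys a" and g: "g \<in> monic_polys b"
  shows "gauss_weight \<psi> \<chi> (f * g) = gauss_weight \<psi> \<chi> f * gauss_weight \<psi> \<chi> g"
proof -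
  note rf = monic_polys_coeffs_in_range[OF f] and rg = monic_polys_coeffs_in_range[OF g]
  have e0: "(-1) ^ degree (f * g) * coeff (f * g) 0 =
      ((-1) ^ degree f * coeff f 0) * ((-1) ^ degree g * coeff g 0)"
    using monic_polysD(4)[OF f] monic_polysD(4)[OF g]
    by (simp add: degree_mult_eq coeff_mult power_add mult_ac)
  have e1: "- coeff (reflect_poly (f * g)) 1 =
      - coeff (reflect_poly f) 1 + - coeff (reflect_poly g) 1"
    using monic_polysD(2)[OF f] monic_polysD(2)[OF g]
    by (simp only: reflect_poly_mult, subst coeff_1_mult_normalized) simp_all
  show ?thesis
    unfolding gauss_weight_def e0 e1 of_ac_mult[OF rf(1) rg(1)] of_ac_add[OF rf(2) rg(2)]
      mult_charD(3)[OF \<chi>] nontrivial_add_charD(2)[OF \<psi>]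
    by (simp only: mult_ac)
qed

lemma gauss_weight_orbit_poly:
  "gauss_weight \<psi> \<chi> (orbit_poly r x) = \<chi> (of_ac (ext_norm r x)) * \<psi> (of_ac (ext_trace r x))"
  unfolding gauss_weight_def coeff_1_reflect_orbit_poly coeff_0_orbit_poly degree_orbit_poly
  by (simp flip: mult.assoc power_mult_distrib)

text \<open>The monic linear polynomials are \<open>X - u\<close>, of weight
  \<open>\<chi> u * \<psi> u\<close>. The term \<open>u = 0\<close> drops out because characters are
  normalised to vanish at 0.\<close>

lemma sum_gauss_weight_1:
  assumes "mult_char \<chi>"
  shows "(\<Sum>f\<in>monic_polys 1. gauss_weight \<psi> \<chi> f) = gauss_sum \<psi> (\<chi> :: 'k::{field,finite} \<Rightarrow> complex)"
proof -
  let ?L = "\<lambda>u :: 'k. [:- to_ac u, 1:]"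
  have "monic_polys 1 = range ?L"
  proof (intro equalityI subsetI)
    fix f :: "'k alg_closure poly" assume f: "f \<in> monic_polys 1"
    have "degree f = 1" "coeff f 1 = 1" using monic_polysD(1)[OF f] coeff_monic_polys[OF f] by auto
    then obtain c where c: "f = [:c, 1:]"
      by (cases f) (auto split: if_splits elim!: degree_eq_zeroE simp: one_pCons)
    have "- c \<in> ext_field 1"
      using monic_polysD(5)[OF f, of 0] by (auto simp: c)
    then obtain u where "- c = to_ac u" unfolding ext_field_1_eq by blast
    then have "c = - to_ac u" by (metis minus_minus)
    then have "f = ?L u" by (simp add: c)
    then show "f \<in> range ?L" by blast
  next
    fix f assume "f \<in> range ?L"
    then obtain u where "f = ?L u" by blast
    moreover have "orbit_poly 1 (to_ac u) \<in> monic_polys 1" by (intro orbit_poly_monic_polys) simp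
    ultimately show "f \<in> monic_polys 1" by (simp add: orbit_poly_def)
  qed
  moreover have "inj ?L" by (auto simp: inj_on_def)
  moreover have "gauss_weight \<psi> \<chi> (?L u) = \<chi> u * \<psi> u" for u
    by (simp add: gauss_weight_def coeff_reflect_poly)
  ultimately have "(\<Sum>f\<in>monic_polys 1. gauss_weight \<psi> \<chi> f) = (\<Sum>u\<in>UNIV. \<chi> u * \<psi> u)"
    by (simp add: sum.reindex)
  also have "\<dots> = gauss_sum \<psi> \<chi>"
    unfolding gauss_sum_def
    by (intro sum.mono_neutral_right) (auto simp: mult_charD[OF assms])
  finally show ?thesis .
qed

text \<open>Changing the coefficient of \<open>X ^ (n - 1)\<close> multiplies the sum by a value of \<open>\<psi>\<close> other than 1.\<close>
lemma sum_gauss_weight_ge_2: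
  fixes \<psi> \<chi> :: "'k::{field,finite} \<Rightarrow> complex"
  assumes \<psi>: "nontrivial_add_char \<psi>" and n: "n \<ge> 2"
  shows "(\<Sum>f\<in>monic_polys n. gauss_weight \<psi> \<chi> f) = 0"
proof -
  obtain u where u: "\<psi> u \<noteq> 1" using \<psi> by (auto simp: nontrivial_add_char_def)
  \<comment> \<open>Since \<open>n \<ge> 2\<close>, the index \<open>n - 1\<close> is neither 0 nor
    \<open>n\<close>: the shift keeps \<open>f\<close> monic and leaves the constant coefficient,
    hence the \<chi> factor, alone.\<close>
  let ?t = "\<lambda>c f. f + monom c (n - 1)"
  have t: "?t c f \<in> monic_polys n" if f: "f \<in> monic_polys n" and c: "c \<in> ext_field 1"
    for c and f :: "'k alg_closure poly"
  proof -
    have deg: "degree (?t c f) = n"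
      using n monic_polysD(1)[OF f] degree_monom_le[of c "n - 1"]
      by (subst degree_add_eq_left) auto
    moreover have "coeff (?t c f) n = 1" using coeff_monic_polys[OF f] n by simp
    moreover have "coeff (?t c f) i \<in> ext_field 1" for i
      using monic_polysD(5)[OF f, of i] c by (auto intro: ext_field_add)
    ultimately show ?thesis by (simp add: monic_polys_def)
  qed
  \<comment> \<open>The sign is chosen because \<psi> is evaluated at minus the coefficient:
    subtracting \<open>u\<close> from the coefficient adds \<open>u\<close> to the argument.\<close>
  have w: "gauss_weight \<psi> \<chi> (?t (- to_ac u) f) = \<psi> u * gauss_weight \<psi> \<chi> f"
    if f: "f \<in> monic_polys n" for f
  proof -
    have deg: "degree (?t (- to_ac u) f) = n"
      by (intro monic_polysD(1) t f ext_field_uminus) auto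
    have c: "- coeff (reflect_poly f) 1 = - coeff f (n - 1)"
      using n monic_polysD(1)[OF f] by (simp add: coeff_reflect_poly)
    have "of_ac (- coeff (?t (- to_ac u) f) (n - 1)) = of_ac (- coeff f (n - 1)) + of_ac (to_ac u)"
      using monic_polys_coeffs_in_range(2)[OF f] unfolding c
      by (subst of_ac_add[symmetric]) auto
    then show ?thesis
      using n deg monic_polysD(1)[OF f]
      by (simp add: gauss_weight_def coeff_reflect_poly nontrivial_add_charD[OF \<psi>])
  qed
  have "(\<Sum>f\<in>monic_polys n. gauss_weight \<psi> \<chi> f) = (\<Sum>f\<in>monic_polys n. gauss_weight \<psi> \<chi> (?t (- to_ac u) f))"
  proof (rule sum.reindex_bij_witness[of _ "?t (- to_ac u)" "?t (to_ac u)"])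
    show "?t (- to_ac u) f \<in> monic_polys n" "?t (to_ac u) f \<in> monic_polys n"
      if "f \<in> monic_polys n" for f
      using that by (intro t; auto)+
  qed (simp_all add: minus_monom[symmetric])
  also have "\<dots> = \<psi> u * (\<Sum>f\<in>monic_polys n. gauss_weight \<psi> \<chi> f)"
    unfolding sum_distrib_left by (intro sum.cong refl w)
  finally show ?thesis using u by (simp add: mult_cancel_right1)
qed

text \<open>With \<open>C 0 = 1\<close>, \<open>C 1\<close> the Gauss sum and all later
  \<open>C n\<close> zero, Newton's identity collapses to \<open>S 1 = C 1\<close> and the
  recurrence \<open>S (r + 1) = - C 1 * S r\<close>.\<close>

theorem hasse_davenport:
  fixes \<psi> \<chi> :: "'k::{field,finite} \<Rightarrow> complex"
  assumes \<chi>: "mult_char \<chi>" and \<psi>: "nontrivial_add_char \<psi>" and r: "r > 0"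
  shows "(\<Sum>x\<in>ext_field r. \<chi> (of_ac (ext_norm r x)) * \<psi> (of_ac (ext_trace r x)))
    = - ((- gauss_sum \<psi> \<chi>) ^ r)"
proof -
  define S where "S = (\<lambda>r. \<Sum>x\<in>ext_field r. gauss_weight \<psi> \<chi> (orbit_poly r x))"
  define C where "C = (\<lambda>n. \<Sum>f\<in>monic_polys n. gauss_weight \<psi> \<chi> f)"
  have newton: "of_nat n * C n = (\<Sum>r\<in>{1..n}. S r * C (n - r))" for n
    unfolding S_def C_def by (rule newton_identity) (rule gauss_weight_mult[OF \<chi> \<psi>])
  have C0: "C 0 = 1"
    using mult_charD(2)[OF \<chi>] nontrivial_add_charD(1)[OF \<psi>] of_ac_to_ac[of "1 :: 'k"] of_ac_to_ac[of "0 :: 'k"]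
    by (simp add: C_def monic_polys_0 gauss_weight_def)
  have C1: "C 1 = gauss_sum \<psi> \<chi>"
    unfolding C_def by (rule sum_gauss_weight_1[OF \<chi>])
  have C2: "C n = 0" if "n \<ge> 2" for n
    unfolding C_def by (rule sum_gauss_weight_ge_2[OF \<psi> that])
  have "S (Suc n) = - ((- gauss_sum \<psi> \<chi>) ^ Suc n)" for n
  proof (induction n)
    case 0
    then show ?case using newton[of 1] C0 C1 by simp
  next
    case (Suc n)
    have "0 = (\<Sum>r\<in>{1..Suc (Suc n)}. S r * C (Suc (Suc n) - r))"
      using newton[of "Suc (Suc n)"] C2[of "Suc (Suc n)"] by simp
    also have "\<dots> = (\<Sum>r\<in>{Suc n, Suc (Suc n)}. S r * C (Suc (Suc n) - r))"
      by (intro sum.mono_neutral_right) (auto simp: C2)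
    also have "\<dots> = S (Suc n) * C 1 + S (Suc (Suc n)) * C 0" by simp
    finally show ?case by (simp add: C0 C1[simplified] Suc eq_neg_iff_add_eq_0 algebra_simps)
  qed
  from this[of "r - 1"] r show ?thesis
    by (simp add: S_def gauss_weight_orbit_poly)
qed

subsection \<open>Characters of given exponent\<close>

lemma finite_field_generator:
  obtains g :: "'k::{field,finite}" where "g \<noteq> 0" "\<forall>u. u \<noteq> 0 \<longrightarrow> (\<exists>i. u = g ^ i)"
proof -
  let ?R = "ring_of_type_algebra :: 'k ring"
  have carr: "carrier (Multiplicative_Group.mult_of ?R) = UNIV - {0}"
    by (simp add: ring_of_type_algebra_def)
  have ops: "x \<otimes>\<^bsub>?R\<^esub> y = x * y" "\<one>\<^bsub>?R\<^esub> = 1" for x y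
    by (auto simp: ring_of_type_algebra_def)
  have fin: "finite (carrier ?R)" by (simp add: ring_of_type_algebra_def)
  interpret R: field ?R by (rule field_from_type_algebra)
  have pow: "x [^]\<^bsub>?R\<^esub> (i::nat) = x ^ i" for x i
    by (induction i) (simp_all only: R.nat_pow_0 R.nat_pow_Suc power_0 power_Suc2 ops)
  from R.finite_field_mult_group_has_gen[OF fin]
  obtain g where g: "g \<in> carrier (Multiplicative_Group.mult_of ?R)" "carrier (Multiplicative_Group.mult_of ?R) = {g [^]\<^bsub>?R\<^esub> i |i::nat. i \<in> UNIV}"
    by (rule bexE) (rule that)
  show ?thesis
  proof (rule that)
    show "g \<noteq> 0" using g(1) unfolding carr by simp
    show "\<forall>u. u \<noteq> 0 \<longrightarrow> (\<exists>i. u = g ^ i)"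
    proof (intro allI impI)
      fix u :: 'k assume "u \<noteq> 0"
      have "u \<in> {g ^ i |i::nat. i \<in> UNIV}"
        using \<open>u \<noteq> 0\<close> unfolding g(2)[unfolded carr pow, symmetric] by simp
      then show "\<exists>i. u = g ^ i" by simp
    qed
  qed
qed

lemma finite_field_power_card_minus_1:
  fixes x :: "'k::{field,finite}"
  assumes "x \<noteq> 0"
  shows "x ^ (CARD('k) - 1) = 1"
proof -
  have "x * x ^ (CARD('k) - 1) = x"
    using finite_field_power_card[of x] finite_field_card_gt_1[where 'k='k]
    by (simp flip: power_Suc)
  then show ?thesis using assms by simp
qed

lemma power_mod_of_power_eq_1:
  fixes x :: "'a::monoid_mult"
  assumes "x ^ m = 1"
  shows "x ^ (i mod m) = x ^ i"
proof -
  have "x ^ i = x ^ (m * (i div m) + i mod m)" by simp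
  also have "\<dots> = x ^ (i mod m)" using assms by (simp only: power_add power_mult) simp
  finally show ?thesis by simp
qed

text \<open>The powers with exponent below \<open>CARD('k) - 1\<close> exhaust the
  \<open>CARD('k) - 1\<close> nonzero elements, so they are pairwise distinct.\<close>

lemma generator_power_eq_iff:
  fixes g :: "'k::{field,finite}"
  assumes g: "g \<noteq> 0" "\<forall>u. u \<noteq> 0 \<longrightarrow> (\<exists>i. u = g ^ i)"
  shows "g ^ i = g ^ j \<longleftrightarrow> i mod (CARD('k) - 1) = j mod (CARD('k) - 1)"
proof -
  let ?N = "CARD('k) - 1"
  have N: "?N > 0" using finite_field_card_gt_1[where 'k='k] by simp
  have red: "g ^ (i mod ?N) = g ^ i" for i
    by (rule power_mod_of_power_eq_1[OF finite_field_power_card_minus_1[OF g(1)]])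
  have "(\<lambda>i. g ^ i) ` {..<?N} = UNIV - {0}"
  proof (intro equalityI subsetI)
    fix u assume "u \<in> UNIV - {0 :: 'k}"
    then obtain i where "u = g ^ i" using g(2) by blast
    then have "u = g ^ (i mod ?N)" by (simp only: red)
    then show "u \<in> (\<lambda>i. g ^ i) ` {..<?N}" using N by auto
  qed (use g(1) in auto)
  then have "card ((\<lambda>i. g ^ i) ` {..<?N}) = card {..<?N}" by (simp add: card_Diff_singleton)
  then have inj: "inj_on (\<lambda>i. g ^ i) {..<?N}" by (intro eq_card_imp_inj_on) auto
  show ?thesis
  proof
    assume "g ^ i = g ^ j"
    then have "g ^ (i mod ?N) = g ^ (j mod ?N)" by (simp only: red)
    then show "i mod ?N = j mod ?N" using inj N by (auto dest: inj_onD)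
  qed (metis red)
qed

text \<open>If \<open>m\<close> does not divide \<open>i\<close>, some \<open>m\<close>-th root of
  unity \<open>w\<close> has \<open>w ^ i \<noteq> 1\<close>, for otherwise all \<open>m\<close> of
  them would solve an equation of degree \<open>i mod m\<close>. Rescaling the sum by
  \<open>w\<close> then shows that it vanishes.\<close>

lemma sum_roots_of_unity_power:
  assumes "m > 0"
  shows "(\<Sum>z\<in>{z::complex. z ^ m = 1}. z ^ i) = (if m dvd i then of_nat m else 0)"
proof -
  let ?U = "{z::complex. z ^ m = 1}"
  have card: "card {z::complex. z ^ l = 1} = l" if "l > 0" for l
    using that by (intro card_nth_roots_alg_closed) auto
  show ?thesis
  proof (cases "m dvd i")
    case True
    then have "z ^ i = 1" if "z \<in> ?U" for z using that by (auto simp: power_mult)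
    then have "(\<Sum>z\<in>?U. z ^ i) = (\<Sum>z\<in>?U. 1)" by (intro sum.cong) auto
    then show ?thesis using True card[OF assms] by simp
  next
    case False
    then have im: "i mod m > 0" "i mod m < m" using assms by (auto simp: mod_greater_zero_iff_not_dvd)
    have "\<exists>w\<in>?U. w ^ i \<noteq> 1"
    proof (rule ccontr)
      assume "\<not> (\<exists>w\<in>?U. w ^ i \<noteq> 1)"
      then have "?U \<subseteq> {z. z ^ (i mod m) = 1}" by (auto simp: power_mod_of_power_eq_1)
      moreover have "finite {z::complex. z ^ (i mod m) = 1}"
        using card[OF im(1)] im(1) by (intro card_ge_0_finite) simp
      ultimately have "card ?U \<le> card {z::complex. z ^ (i mod m) = 1}" by (intro card_mono)
      then show False using card[OF assms] card[OF im(1)] im by simp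
    qed
    then obtain w :: complex where w: "w ^ m = 1" "w ^ i \<noteq> 1" by auto
    then have "w \<noteq> 0" using assms by (auto simp: power_0_left)
    have "(\<Sum>z\<in>?U. z ^ i) = (\<Sum>z\<in>?U. (w * z) ^ i)"
      by (rule sum.reindex_bij_witness[of _ "\<lambda>z. w * z" "\<lambda>z. z / w"])
         (use w \<open>w \<noteq> 0\<close> in \<open>auto simp: power_mult_distrib power_divide\<close>)
    also have "\<dots> = w ^ i * (\<Sum>z\<in>?U. z ^ i)"
      by (simp add: power_mult_distrib sum_distrib_left)
    finally show ?thesis using w False by (simp add: mult_cancel_right1)
  qed
qed

text \<open>The character group of the units modulo \<open>m\<close>-th powers.\<close>

definition mult_chars_of_exponent :: "nat \<Rightarrow> ('k::field \<Rightarrow> complex) set" where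
  "mult_chars_of_exponent m = {\<chi>. mult_char \<chi> \<and> (\<forall>u. u \<noteq> 0 \<longrightarrow> \<chi> u ^ m = 1)}"

lemma mult_char_power:
  assumes "mult_char \<chi>"
  shows "\<chi> (u ^ i) = \<chi> u ^ i"
  by (induction i) (simp_all add: mult_charD[OF assms])

lemma mult_chars_bij_roots_of_unity:
  fixes g :: "'k::{field,finite}"
  assumes g: "g \<noteq> 0" "\<forall>u. u \<noteq> 0 \<longrightarrow> (\<exists>i. u = g ^ i)" and m: "m dvd CARD('k) - 1"
  shows "bij_betw (\<lambda>\<chi>. \<chi> g) (mult_chars_of_exponent m) {z. z ^ m = 1}"
proof (rule bij_betwI')
  fix \<chi> \<chi>' :: "'k \<Rightarrow> complex"
  assume *: "\<chi> \<in> mult_chars_of_exponent m" "\<chi>' \<in> mult_chars_of_exponent m"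
  then have mc: "mult_char \<chi>" "mult_char \<chi>'" by (auto simp: mult_chars_of_exponent_def)
  show "\<chi> g = \<chi>' g \<longleftrightarrow> \<chi> = \<chi>'"
  proof
    assume eq: "\<chi> g = \<chi>' g"
    show "\<chi> = \<chi>'"
    proof
      fix u
      show "\<chi> u = \<chi>' u"
      proof (cases "u = 0")
        case False
        then obtain i where "u = g ^ i" using g(2) by blast
        then show ?thesis using eq by (simp add: mult_char_power mc)
      qed (simp add: mult_charD mc)
    qed
  qed simp
next
  fix \<chi> :: "'k \<Rightarrow> complex" assume "\<chi> \<in> mult_chars_of_exponent m"
  then show "\<chi> g \<in> {z. z ^ m = 1}" using g(1) by (auto simp: mult_chars_of_exponent_def)
next
  fix z :: complex assume "z \<in> {z. z ^ m = 1}"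
  then have z: "z ^ m = 1" by simp
  \<comment> \<open>The character sending \<open>g\<close> to \<open>z\<close>, through an
    arbitrarily chosen discrete logarithm. Two logarithms of the same element agree modulo
    \<open>CARD('k) - 1\<close>, hence modulo \<open>m\<close>, so the choice does not affect the
    power of \<open>z\<close>.\<close>
  define \<chi> where "\<chi> u = (if u = 0 then 0 else z ^ (SOME i. u = g ^ i))" for u
  have \<chi>: "\<chi> (g ^ i) = z ^ i" for i
  proof -
    let ?j = "SOME j. g ^ i = g ^ j"
    have "g ^ i = g ^ ?j" by (rule someI[of _ i]) simp
    then have "i mod (CARD('k) - 1) = ?j mod (CARD('k) - 1)"
      by (rule generator_power_eq_iff[OF g, THEN iffD1])
    then have "i mod m = ?j mod m" using m by (metis mod_mod_cancel)
    then have "z ^ i = z ^ ?j" using power_mod_of_power_eq_1[OF z] by metis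
    then show ?thesis using g(1) by (simp add: \<chi>_def)
  qed
  have "mult_char \<chi>"
    unfolding mult_char_def
  proof (intro conjI allI)
    show "\<chi> 0 = 0" by (simp add: \<chi>_def)
    show "\<chi> 1 = 1" using \<chi>[of 0] by simp
    fix x y
    show "\<chi> (x * y) = \<chi> x * \<chi> y"
    proof (cases "x = 0 \<or> y = 0")
      case False
      then obtain i j where "x = g ^ i" "y = g ^ j" using g(2) by meson
      then show ?thesis by (simp add: \<chi> flip: power_add)
    qed (auto simp: \<chi>_def)
  qed
  moreover have "\<chi> u ^ m = 1" if "u \<noteq> 0" for u
    using z by (simp add: \<chi>_def that mult.commute flip: power_mult) (simp add: power_mult)
  ultimately show "\<exists>\<chi>\<in>mult_chars_of_exponent m. z = \<chi> g"
    using \<chi>[of 1] by (intro bexI[of _ \<chi>]) (auto simp: mult_chars_of_exponent_def)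
qed

lemma finite_mult_chars_of_exponent:
  assumes "m dvd CARD('k) - 1"
  shows "finite (mult_chars_of_exponent m :: ('k::{field,finite} \<Rightarrow> complex) set)"
proof -
  obtain g :: 'k where g: "g \<noteq> 0" "\<forall>u. u \<noteq> 0 \<longrightarrow> (\<exists>i. u = g ^ i)"
    using finite_field_generator by metis
  have "m > 0" using assms finite_field_card_gt_1[where 'k='k] by (intro Nat.gr0I) auto
  then have "finite {z::complex. z ^ m = 1}" by (intro finite_roots_unity) auto
  then show ?thesis using bij_betw_finite[OF mult_chars_bij_roots_of_unity[OF g assms]] by blast
qed

text \<open>Orthogonality, read through the value at a generator. The condition on the right is
  Euler's criterion for \<open>u\<close> to be an \<open>m\<close>-th power.\<close>

lemma sum_mult_chars_of_exponent:
  fixes u :: "'k::{field,finite}"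
  assumes m: "m dvd CARD('k) - 1" and u: "u \<noteq> 0"
  shows "(\<Sum>\<chi>\<in>mult_chars_of_exponent m. \<chi> u)
    = (if u ^ ((CARD('k) - 1) div m) = 1 then of_nat m else 0)"
proof -
  obtain g :: 'k where g: "g \<noteq> 0" "\<forall>u. u \<noteq> 0 \<longrightarrow> (\<exists>i. u = g ^ i)"
    using finite_field_generator by metis
  obtain i where i: "u = g ^ i" using g(2) u by blast
  have N: "CARD('k) - 1 > 0" using finite_field_card_gt_1[where 'k='k] by simp
  then have m0: "m > 0" using m by (intro Nat.gr0I) auto
  obtain l where l: "CARD('k) - 1 = m * l" using m by (elim dvdE)
  with N have l0: "l > 0" by (intro Nat.gr0I) auto
  have "(\<Sum>\<chi>\<in>mult_chars_of_exponent m. \<chi> u) = (\<Sum>\<chi>\<in>mult_chars_of_exponent m. \<chi> g ^ i)"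
    by (intro sum.cong refl) (auto simp: i mult_char_power mult_chars_of_exponent_def)
  also have "\<dots> = (\<Sum>z\<in>{z. z ^ m = 1}. z ^ i)"
    by (rule sum.reindex_bij_betw[OF mult_chars_bij_roots_of_unity[OF g m]])
  also have "\<dots> = (if m dvd i then of_nat m else 0)"
    by (rule sum_roots_of_unity_power[OF m0])
  also have "m dvd i \<longleftrightarrow> u ^ ((CARD('k) - 1) div m) = 1"
  proof -
    have p: "u ^ ((CARD('k) - 1) div m) = g ^ (i * l)" unfolding l i using m0 by (simp add: power_mult)
    have "u ^ ((CARD('k) - 1) div m) = 1 \<longleftrightarrow> g ^ (i * l) = g ^ 0" by (simp only: p power_0)
    also have "\<dots> \<longleftrightarrow> m * l dvd i * l" by (simp only: generator_power_eq_iff[OF g] l dvd_eq_mod_eq_0 mod_0)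
    also have "\<dots> \<longleftrightarrow> m dvd i" using l0 by simp
    finally show ?thesis by simp
  qed
  finally show ?thesis .
qed

section \<open>The norm map and \<open>m\<close>-th roots in extensions\<close>

lemma ext_norm_eq_power: "ext_norm r x = x ^ (\<Sum>i<r. CARD('k) ^ i)"
  for x :: "'k::{field,finite} alg_closure"
  by (simp add: ext_norm_def power_sum)

lemma geometric_sum_nat: "q \<ge> 1 \<Longrightarrow> (q - 1) * (\<Sum>i<r. q ^ i) = q ^ r - (1::nat)"
  by (induction r) (auto simp: algebra_simps diff_mult_distrib)

lemma ext_norm_mult: "ext_norm r (x * y) = ext_norm r x * ext_norm r y"
  by (simp add: ext_norm_def power_mult_distrib prod.distrib)

lemma ext_norm_eq_0_iff: "r > 0 \<Longrightarrow> ext_norm r x = 0 \<longleftrightarrow> x = 0"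
  by (auto simp: ext_norm_def)

lemma ext_norm_to_ac: "ext_norm r (to_ac c) = to_ac (c ^ r)"
proof -
  have "to_ac c ^ (CARD('a) ^ i) = to_ac c" for i
    using to_ac_in_ext_field[of c i] by (simp add: ext_field_def)
  then show ?thesis by (simp add: ext_norm_def)
qed

text \<open>The norm is the power with exponent \<open>(q ^ r - 1) / (q - 1)\<close>, where
  \<open>q = CARD('k)\<close>. A root of that order of \<open>u\<close> exists in the closure, and
  it lies in the extension because its power \<open>q ^ r - 1\<close> equals
  \<open>u ^ (q - 1) = 1\<close>.\<close>

lemma ext_norm_surj:
  fixes u :: "'k::{field,finite}"
  assumes r: "r > 0" and u: "u \<noteq> 0"
  obtains y where "y \<in> ext_field r" "y \<noteq> 0" "ext_norm r y = to_ac u"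
proof -
  let ?E = "\<Sum>i<r. CARD('k) ^ i"
  have "?E > 0" using r by (intro sum_pos) auto
  then obtain y where y: "y ^ ?E = to_ac u" using nth_root_exists by blast
  have y0: "y \<noteq> 0"
  proof
    assume "y = 0"
    then have "to_ac u = 0" using y zero_power[OF \<open>?E > 0\<close>] by metis
    then show False using u by simp
  qed
  have "y ^ (CARD('k) ^ r - 1) = (y ^ ?E) ^ (CARD('k) - 1)"
    using finite_field_card_gt_1[where 'k='k]
    by (simp add: geometric_sum_nat[symmetric] mult.commute del: One_nat_def flip: power_mult)
  also have "\<dots> = 1" using finite_field_power_card_minus_1[OF u] by (simp add: y flip: to_ac_power)
  finally have "y \<in> ext_field r" using y0 by (simp add: ext_field_power_iff)
  then show ?thesis using that y y0 by (simp add: ext_norm_eq_power)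
qed

lemma card_minus_1_dvd: "CARD('k::{field,finite}) - 1 dvd CARD('k) ^ r - 1"
  using geometric_sum_nat[of "CARD('k)" r] finite_field_card_gt_1[where 'k='k]
  by (metis dvd_triv_left less_imp_le_nat)

text \<open>\<open>CARD('k) - 1\<close> is -1 in the field, so its divisors are invertible. This
  makes \<open>X ^ m - v\<close> separable for nonzero \<open>v\<close>.\<close>

lemma ac_of_nat_dvd_neq_0:
  assumes "m dvd CARD('k::{field,finite}) - 1"
  shows "of_nat m \<noteq> (0 :: 'k alg_closure)"
proof
  assume "of_nat m = (0 :: 'k alg_closure)"
  then have "of_nat (CARD('k) - 1) = (0 :: 'k alg_closure)" using assms by (elim dvdE) simp
  then show False
    using ac_of_nat_card[where 'k='k] finite_field_card_gt_1[where 'k='k] by (simp add: of_nat_diff)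
qed

text \<open>Any root \<open>x\<close> in the closure satisfies \<open>x ^ (m * l) = v ^ l\<close>,
  where \<open>m * l = CARD('k) ^ r - 1\<close>. So the \<open>m\<close> roots lie in the extension
  either all together or not at all.\<close>

lemma card_nth_roots_ext_field:
  fixes v :: "'k::{field,finite} alg_closure"
  assumes m: "m dvd CARD('k) - 1" and v: "v \<noteq> 0"
  shows "card {x \<in> ext_field r - {0}. x ^ m = v}
    = (if v ^ ((CARD('k) ^ r - 1) div m) = 1 then m else 0)"
proof -
  have m0: "m > 0" using m finite_field_card_gt_1[where 'k='k] by (intro Nat.gr0I) auto
  have "m dvd CARD('k) ^ r - 1" using m card_minus_1_dvd[where 'k='k] dvd_trans by blast
  then obtain l where l: "CARD('k) ^ r - 1 = m * l" by (elim dvdE)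
  have "{x \<in> ext_field r - {0}. x ^ m = v} = (if v ^ l = 1 then {x. x ^ m = v} else {})"
    using v m0 by (auto simp: ext_field_power_iff l power_mult power_0_left simp del: One_nat_def)
  then show ?thesis
    using card_nth_roots_alg_closed[OF ac_of_nat_dvd_neq_0[OF m] v] m0
    by (simp add: l del: One_nat_def)
qed

text \<open>The criterion for \<open>v\<close> in the extension is the criterion for its norm in the
  base field, since the exponent for \<open>v\<close> is the exponent for the norm times the norm
  exponent. Characters of the base field composed with the norm therefore suffice.\<close>

lemma card_nth_roots_eq_sum_mult_chars:
  fixes v :: "'k::{field,finite} alg_closure"
  assumes m: "m dvd CARD('k) - 1" and v: "v \<noteq> 0" "v \<in> ext_field r" and r: "r > 0"
  shows "of_nat (card {x \<in> ext_field r - {0}. x ^ m = v})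
    = (\<Sum>\<chi>\<in>mult_chars_of_exponent m. \<chi> (of_ac (ext_norm r v)))"
proof -
  have q1: "CARD('k) \<ge> 1" using finite_field_card_gt_1[where 'k='k] by simp
  have m0: "m > 0" using m finite_field_card_gt_1[where 'k='k] by (intro Nat.gr0I) auto
  obtain u where u: "ext_norm r v = to_ac u" using ext_norm_in_range[OF v(2)] by blast
  then have "u \<noteq> 0" using v(1) r by (metis ext_norm_eq_0_iff to_ac_0)
  obtain l where l: "CARD('k) - 1 = m * l" using m by (elim dvdE)
  have "u ^ l = 1 \<longleftrightarrow> to_ac u ^ l = 1" by (simp flip: to_ac_power)
  also have "to_ac u ^ l = v ^ (l * (\<Sum>i<r. CARD('k) ^ i))"
    by (simp add: u[symmetric] ext_norm_eq_power mult.commute flip: power_mult)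
  also have "l * (\<Sum>i<r. CARD('k) ^ i) = (CARD('k) ^ r - 1) div m"
    using m0 by (simp only: geometric_sum_nat[OF q1, symmetric] l mult.assoc) simp
  finally show ?thesis
    using \<open>u \<noteq> 0\<close> m0 card_nth_roots_ext_field[OF m v(1)]
    by (simp add: u sum_mult_chars_of_exponent[OF m] l del: One_nat_def)
qed

subsection \<open>Points of diagonal equations on the torus\<close>

lemma sum_add_char:
  fixes \<psi> :: "'k::{field,finite} \<Rightarrow> complex"
  assumes "nontrivial_add_char \<psi>"
  shows "(\<Sum>u\<in>UNIV. \<psi> u) = 0"
proof -
  obtain v where v: "\<psi> v \<noteq> 1" using assms by (auto simp: nontrivial_add_char_def)
  have "(\<Sum>u\<in>UNIV. \<psi> u) = (\<Sum>u\<in>UNIV. \<psi> (v + u))"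
    by (rule sum.reindex_bij_witness[of _ "\<lambda>u. v + u" "\<lambda>u. u - v"]) auto
  also have "\<dots> = \<psi> v * (\<Sum>u\<in>UNIV. \<psi> u)"
    by (simp add: nontrivial_add_charD[OF assms] sum_distrib_left)
  finally show ?thesis using v by (simp add: mult_cancel_right1)
qed

lemma mult_char_trivial: "mult_char trivial_mult_char"
  by (auto simp: mult_char_def trivial_mult_char_def)

lemma gauss_sum_trivial:
  fixes \<psi> :: "'k::{field,finite} \<Rightarrow> complex"
  assumes "nontrivial_add_char \<psi>"
  shows "gauss_sum \<psi> trivial_mult_char = -1"
proof -
  have "gauss_sum \<psi> trivial_mult_char = (\<Sum>u\<in>UNIV - {0}. \<psi> u)"
    unfolding gauss_sum_def by (intro sum.cong) (auto simp: trivial_mult_char_def)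
  also have "\<dots> = -1"
    using sum_add_char[OF assms] sum.remove[of UNIV "0 :: 'k" \<psi>] nontrivial_add_charD(1)[OF assms]
    by (simp add: add_eq_0_iff)
  finally show ?thesis .
qed

lemma norm_mult_char:
  fixes \<chi> :: "'k::{field,finite} \<Rightarrow> complex"
  assumes "mult_char \<chi>" "u \<noteq> 0"
  shows "norm (\<chi> u) = 1"
proof -
  have "norm (\<chi> u) ^ (CARD('k) - 1) = norm (\<chi> (u ^ (CARD('k) - 1)))"
    by (simp only: mult_char_power[OF assms(1)] norm_power)
  also have "\<dots> = 1"
    using finite_field_power_card_minus_1[OF assms(2)] mult_charD(2)[OF assms(1)] by simp
  finally show ?thesis
    using finite_field_card_gt_1[where 'k='k]
      power_eq_imp_eq_base[of "norm (\<chi> u)" "CARD('k) - 1" 1] by simp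
qed

lemma mult_char_mult_cnj:
  fixes \<chi> :: "'k::{field,finite} \<Rightarrow> complex"
  assumes "mult_char \<chi>" "u \<noteq> 0"
  shows "\<chi> u * cnj (\<chi> u) = 1"
  using norm_mult_char[OF assms] by (simp flip: complex_norm_square)

section \<open>Lifted characters and their orthogonality\<close>

definition ext_add_char :: "('k::{field,finite} \<Rightarrow> complex) \<Rightarrow> nat \<Rightarrow> 'k alg_closure \<Rightarrow> complex" where
  "ext_add_char \<psi> r x = \<psi> (of_ac (ext_trace r x))"

definition ext_mult_char :: "('k::{field,finite} \<Rightarrow> complex) \<Rightarrow> nat \<Rightarrow> 'k alg_closure \<Rightarrow> complex" where
  "ext_mult_char \<chi> r x = \<chi> (of_ac (ext_norm r x))"

lemma ext_trace_add: "ext_trace r (x + y) = ext_trace r x + ext_trace r y"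
  by (simp add: ext_trace_def ac_power_card_power_add sum.distrib)

lemma ext_add_char_add:
  assumes "nontrivial_add_char \<psi>" "x \<in> ext_field r" "y \<in> ext_field r"
  shows "ext_add_char \<psi> r (x + y) = ext_add_char \<psi> r x * ext_add_char \<psi> r y"
  unfolding ext_add_char_def ext_trace_add
  by (simp add: of_ac_add ext_trace_in_range assms nontrivial_add_charD(2)[OF assms(1)])

lemma ext_add_char_0:
  assumes "nontrivial_add_char \<psi>"
  shows "ext_add_char \<psi> r 0 = 1"
  using of_ac_to_ac[of "0 :: 'a"] nontrivial_add_charD(1)[OF assms]
  by (simp add: ext_add_char_def ext_trace_def power_0_left)

lemma ext_add_char_sum:
  assumes "nontrivial_add_char \<psi>" "\<And>i. i \<in> S \<Longrightarrow> f i \<in> ext_field r"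
  shows "ext_add_char \<psi> r (\<Sum>i\<in>S. f i) = (\<Prod>i\<in>S. ext_add_char \<psi> r (f i))"
  using assms(2)
proof (induction S rule: infinite_finite_induct)
  case (insert i S)
  then have "(\<Sum>i\<in>S. f i) \<in> ext_field r" by auto
  then show ?case using insert by (simp add: ext_add_char_add assms(1))
qed (simp_all add: ext_add_char_0 assms(1))

lemma ext_mult_char_mult:
  assumes "mult_char \<chi>" "x \<in> ext_field r" "y \<in> ext_field r"
  shows "ext_mult_char \<chi> r (x * y) = ext_mult_char \<chi> r x * ext_mult_char \<chi> r y"
  unfolding ext_mult_char_def ext_norm_mult
  by (simp add: of_ac_mult ext_norm_in_range assms mult_charD(3)[OF assms(1)])

lemma ext_mult_char_to_ac:
  assumes "mult_char \<chi>"
  shows "ext_mult_char \<chi> r (to_ac c) = \<chi> c ^ r"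
  by (simp add: ext_mult_char_def ext_norm_to_ac mult_char_power[OF assms] del: to_ac_power)

lemma ext_mult_char_0:
  assumes "mult_char \<chi>" "r > 0"
  shows "ext_mult_char \<chi> r 0 = 0"
  using of_ac_to_ac[of "0 :: 'a"] ext_norm_eq_0_iff[OF assms(2), of "0 :: 'a alg_closure"] mult_charD(1)[OF assms(1)]
  by (simp add: ext_mult_char_def)

lemma of_ac_ext_norm_nonzero:
  assumes "x \<in> ext_field r" "x \<noteq> 0"
  shows "of_ac (ext_norm r x) \<noteq> 0"
proof
  assume *: "of_ac (ext_norm r x) = 0"
  have "ext_norm r x = to_ac (of_ac (ext_norm r x))"
    using ext_norm_in_range[OF assms(1)] by (simp add: to_ac_of_ac)
  then have "ext_norm r x = 0" using * by simp
  then show False using assms(2) by (auto simp: ext_norm_def)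
qed

lemma ext_mult_char_mult_cnj:
  assumes "mult_char \<chi>" "x \<in> ext_field r" "x \<noteq> 0"
  shows "ext_mult_char \<chi> r x * cnj (ext_mult_char \<chi> r x) = 1"
  unfolding ext_mult_char_def
  by (rule mult_char_mult_cnj[OF assms(1) of_ac_ext_norm_nonzero[OF assms(2,3)]])

lemma sum_ext_mult_char_add_char:
  fixes \<psi> :: "'k::{field,finite} \<Rightarrow> complex"
  assumes "mult_char \<chi>" "nontrivial_add_char \<psi>" "r > 0"
  shows "(\<Sum>x\<in>ext_field r - {0}. ext_mult_char \<chi> r x * ext_add_char \<psi> r x)
    = - ((- gauss_sum \<psi> \<chi>) ^ r)"
proof -
  have "(\<Sum>x\<in>ext_field r - {0}. ext_mult_char \<chi> r x * ext_add_char \<psi> r x)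
      = (\<Sum>x\<in>ext_field r. ext_mult_char \<chi> r x * ext_add_char \<psi> r x)"
    by (intro sum.mono_neutral_left) (auto simp: finite_ext_field assms ext_mult_char_0)
  then show ?thesis
    using hasse_davenport[OF assms] by (simp add: ext_mult_char_def ext_add_char_def)
qed

text \<open>Nontriviality of \<open>ext_add_char\<close> is the case \<open>\<chi> = \<epsilon>\<close> of the Hasse-Davenport relation.\<close>
lemma sum_ext_add_char:
  fixes \<psi> :: "'k::{field,finite} \<Rightarrow> complex"
  assumes \<psi>: "nontrivial_add_char \<psi>" and r: "r > 0" and z: "z \<in> ext_field r"
  shows "(\<Sum>y\<in>ext_field r. ext_add_char \<psi> r (y * z)) = (if z = 0 then of_nat (CARD('k) ^ r) else 0)"
proof (cases "z = 0")
  case True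
  then show ?thesis using card_ext_field[OF r, where 'k='k] by (simp add: ext_add_char_0[OF \<psi>])
next
  case False
  have "(\<Sum>y\<in>ext_field r. ext_add_char \<psi> r (y * z)) = (\<Sum>y\<in>ext_field r. ext_add_char \<psi> r y)"
    by (rule sum.reindex_bij_witness[of _ "\<lambda>y. y / z" "\<lambda>y. y * z"])
       (use False z in \<open>auto intro: ext_field_divide ext_field_mult\<close>)
  also have "\<dots> = ext_add_char \<psi> r 0 + (\<Sum>y\<in>ext_field r - {0}. ext_add_char \<psi> r y)"
    by (rule sum.remove) (auto simp: finite_ext_field r)
  also have "(\<Sum>y\<in>ext_field r - {0}. ext_add_char \<psi> r y)
      = (\<Sum>y\<in>ext_field r - {0}. ext_mult_char trivial_mult_char r y * ext_add_char \<psi> r y)"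
    by (intro sum.cong refl)
       (auto simp: ext_mult_char_def trivial_mult_char_def dest!: of_ac_ext_norm_nonzero)
  also have "\<dots> = -1"
    by (simp add: sum_ext_mult_char_add_char[OF mult_char_trivial \<psi> r] gauss_sum_trivial[OF \<psi>])
  finally show ?thesis using False by (simp add: ext_add_char_0[OF \<psi>])
qed

text \<open>Surjectivity of the norm carries a unit with \<open>\<chi> u \<noteq> 1\<close> to an
  element \<open>v\<close> of the extension, and rescaling by \<open>v\<close> kills the sum.
  Conjugates appear because rescaling a Gauss sum produces them.\<close>

lemma sum_cnj_ext_mult_char:
  fixes \<chi> :: "'k::{field,finite} \<Rightarrow> complex"
  assumes \<chi>: "mult_char \<chi>" and r: "r > 0"
  shows "(\<Sum>y\<in>ext_field r - {0}. cnj (ext_mult_char \<chi> r y))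
    = (if \<forall>u. u \<noteq> 0 \<longrightarrow> \<chi> u = 1 then of_nat (CARD('k) ^ r - 1) else 0)"
proof (cases "\<forall>u. u \<noteq> 0 \<longrightarrow> \<chi> u = 1")
  case True
  have "(\<Sum>y\<in>ext_field r - {0}. cnj (ext_mult_char \<chi> r y)) = (\<Sum>y\<in>(ext_field r :: 'k alg_closure set) - {0}. 1)"
    by (intro sum.cong refl) (auto simp: ext_mult_char_def True dest!: of_ac_ext_norm_nonzero)
  also have "\<dots> = of_nat (CARD('k) ^ r - 1)"
    by (simp add: card_Diff_singleton card_ext_field r)
  finally show ?thesis using True by simp
next
  case False
  then obtain u where u: "u \<noteq> 0" "\<chi> u \<noteq> 1" by auto
  obtain v where v: "v \<in> ext_field r" "v \<noteq> 0" "ext_norm r v = to_ac u"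
    using ext_norm_surj[OF r u(1)] by blast
  have "ext_mult_char \<chi> r v = \<chi> u" by (simp add: ext_mult_char_def v)
  have "(\<Sum>y\<in>ext_field r - {0}. cnj (ext_mult_char \<chi> r y))
      = (\<Sum>y\<in>ext_field r - {0}. cnj (ext_mult_char \<chi> r (v * y)))"
    by (rule sum.reindex_bij_witness[of _ "\<lambda>y. v * y" "\<lambda>y. y / v"])
       (use v in \<open>auto intro: ext_field_divide ext_field_mult\<close>)
  also have "\<dots> = cnj (\<chi> u) * (\<Sum>y\<in>ext_field r - {0}. cnj (ext_mult_char \<chi> r y))"
    unfolding sum_distrib_left
    by (intro sum.cong refl) (auto simp: ext_mult_char_mult \<chi> v \<open>ext_mult_char \<chi> r v = \<chi> u\<close>)
  finally have "(\<Sum>y\<in>ext_field r - {0}. cnj (ext_mult_char \<chi> r y)) = 0 \<or> cnj (\<chi> u) = 1"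
    by (simp add: mult_cancel_right1)
  then show ?thesis using False u complex_cnj_cancel_iff[of "\<chi> u" 1] by auto
qed

text \<open>Group by \<open>v = x ^ m\<close> and replace the number of roots by a sum over
  characters. Rescaling by \<open>c = y * to_ac b\<close> pulls out a conjugate character value and
  leaves a Gauss sum of the extension, which Hasse-Davenport evaluates.\<close>

lemma sum_ext_add_char_power:
  fixes \<psi> :: "'k::{field,finite} \<Rightarrow> complex"
  assumes \<psi>: "nontrivial_add_char \<psi>" and r: "r > 0" and m: "m dvd CARD('k) - 1"
    and b: "b \<noteq> 0" and y: "y \<in> ext_field r" "y \<noteq> 0"
  shows "(\<Sum>x\<in>ext_field r - {0}. ext_add_char \<psi> r (y * (to_ac b * x ^ m)))
    = (\<Sum>\<chi>\<in>mult_chars_of_exponent m.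
        cnj (ext_mult_char \<chi> r y) * - ((- cnj (\<chi> b) * gauss_sum \<psi> \<chi>) ^ r))"
proof -
  let ?K = "ext_field r - {0 :: 'k alg_closure}"
  let ?X = "mult_chars_of_exponent m :: ('k \<Rightarrow> complex) set"
  define c where "c = y * to_ac b"
  have c: "c \<in> ext_field r" "c \<noteq> 0" using y b by (auto simp: c_def intro: ext_field_mult)
  have fin: "finite ?K" by (simp add: finite_ext_field r)
  have "m > 0" using m finite_field_card_gt_1[where 'k='k] by (intro Nat.gr0I) auto
  have img: "(\<lambda>x. x ^ m) ` ?K \<subseteq> ?K" by (auto intro: ext_field_power)
  have "(\<Sum>x\<in>?K. ext_add_char \<psi> r (y * (to_ac b * x ^ m))) = (\<Sum>x\<in>?K. ext_add_char \<psi> r (c * x ^ m))"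
    by (simp add: c_def mult.assoc)
  also have "\<dots> = (\<Sum>v\<in>?K. \<Sum>x\<in>{x\<in>?K. x ^ m = v}. ext_add_char \<psi> r (c * x ^ m))"
    by (rule sum.group[OF fin fin img, symmetric])
  also have "\<dots> = (\<Sum>v\<in>?K. of_nat (card {x\<in>?K. x ^ m = v}) * ext_add_char \<psi> r (c * v))"
    by (intro sum.cong refl) simp
  also have "\<dots> = (\<Sum>v\<in>?K. (\<Sum>\<chi>\<in>?X. ext_mult_char \<chi> r v) * ext_add_char \<psi> r (c * v))"
    unfolding ext_mult_char_def
    by (intro sum.cong refl arg_cong2[of _ _ _ _ "(*)"] card_nth_roots_eq_sum_mult_chars[OF m _ _ r]) auto
  also have "\<dots> = (\<Sum>\<chi>\<in>?X. \<Sum>v\<in>?K. ext_mult_char \<chi> r v * ext_add_char \<psi> r (c * v))"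
    by (simp only: sum_distrib_right) (rule sum.swap)
  also have "\<dots> = (\<Sum>\<chi>\<in>?X. cnj (ext_mult_char \<chi> r c) * - ((- gauss_sum \<psi> \<chi>) ^ r))"
  proof (intro sum.cong refl)
    fix \<chi> assume "\<chi> \<in> ?X"
    then have \<chi>: "mult_char \<chi>" by (simp add: mult_chars_of_exponent_def)
    have "(\<Sum>v\<in>?K. ext_mult_char \<chi> r v * ext_add_char \<psi> r (c * v)) =
        (\<Sum>v\<in>?K. cnj (ext_mult_char \<chi> r c) * (ext_mult_char \<chi> r (c * v) * ext_add_char \<psi> r (c * v)))"
    proof (intro sum.cong refl)
      fix v assume v: "v \<in> ?K"
      have "cnj (ext_mult_char \<chi> r c) * ext_mult_char \<chi> r (c * v)
          = (ext_mult_char \<chi> r c * cnj (ext_mult_char \<chi> r c)) * ext_mult_char \<chi> r v"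
        using v c by (simp add: ext_mult_char_mult \<chi>)
      then show "ext_mult_char \<chi> r v * ext_add_char \<psi> r (c * v) =
          cnj (ext_mult_char \<chi> r c) * (ext_mult_char \<chi> r (c * v) * ext_add_char \<psi> r (c * v))"
        using ext_mult_char_mult_cnj[OF \<chi> c] by (simp flip: mult.assoc)
    qed
    also have "\<dots> = cnj (ext_mult_char \<chi> r c) *
        (\<Sum>v\<in>?K. ext_mult_char \<chi> r (c * v) * ext_add_char \<psi> r (c * v))"
      by (simp add: sum_distrib_left)
    also have "(\<Sum>v\<in>?K. ext_mult_char \<chi> r (c * v) * ext_add_char \<psi> r (c * v))
        = (\<Sum>v\<in>?K. ext_mult_char \<chi> r v * ext_add_char \<psi> r v)"
      by (rule sum.reindex_bij_witness[of _ "\<lambda>v. v / c" "\<lambda>v. c * v"])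
         (use c in \<open>auto intro: ext_field_divide ext_field_mult\<close>)
    finally show "(\<Sum>v\<in>?K. ext_mult_char \<chi> r v * ext_add_char \<psi> r (c * v))
        = cnj (ext_mult_char \<chi> r c) * - ((- gauss_sum \<psi> \<chi>) ^ r)"
      by (simp only: sum_ext_mult_char_add_char[OF \<chi> \<psi> r])
  qed
  also have "\<dots> = (\<Sum>\<chi>\<in>?X. cnj (ext_mult_char \<chi> r y) * - ((- cnj (\<chi> b) * gauss_sum \<psi> \<chi>) ^ r))"
  proof (intro sum.cong refl)
    fix \<chi> assume "\<chi> \<in> ?X"
    then have \<chi>: "mult_char \<chi>" by (simp add: mult_chars_of_exponent_def)
    \<comment> \<open>The norm of a base field element is its \<open>r\<close>-th power, so the
      contribution of \<open>b\<close> can be absorbed into the \<open>r\<close>-th power.\<close>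
    have "cnj (ext_mult_char \<chi> r c) = cnj (ext_mult_char \<chi> r y) * cnj (\<chi> b) ^ r"
      unfolding c_def using y by (simp add: ext_mult_char_mult ext_mult_char_to_ac \<chi>)
    moreover have "(- cnj (\<chi> b) * gauss_sum \<psi> \<chi>) ^ r = cnj (\<chi> b) ^ r * (- gauss_sum \<psi> \<chi>) ^ r"
      by (simp flip: power_mult_distrib)
    ultimately show "cnj (ext_mult_char \<chi> r c) * - ((- gauss_sum \<psi> \<chi>) ^ r)
        = cnj (ext_mult_char \<chi> r y) * - ((- cnj (\<chi> b) * gauss_sum \<psi> \<chi>) ^ r)"
      by simp
  qed
  finally show ?thesis .
qed

lemma char_tuples_eq:
  "char_tuples m S = {\<chi> \<in> (\<Pi>\<^sub>E i\<in>S. mult_chars_of_exponent (m i)).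
     \<forall>u. u \<noteq> 0 \<longrightarrow> (\<Prod>i\<in>S. \<chi> i u) = 1}"
  by (auto simp: char_tuples_def mult_chars_of_exponent_def PiE_iff)

definition torus_points ::
    "(nat \<Rightarrow> 'k::{field,finite}) \<Rightarrow> (nat \<Rightarrow> nat) \<Rightarrow> nat set \<Rightarrow> nat \<Rightarrow> (nat \<Rightarrow> 'k alg_closure) set" where
  "torus_points a m S r =
     {x \<in> S \<rightarrow>\<^sub>E ext_field r - {0}. (\<Sum>i\<in>S. to_ac (a i) * x i ^ m i) = 0}"

text \<open>Multiplying by the field size turns the equation into a sum of additive characters over
  \<open>y\<close>, which factors over the coordinates. The term \<open>y = 0\<close> gives the
  first summand. For \<open>y \<noteq> 0\<close> expand each factor over characters; summing over
  \<open>y\<close> keeps only tuples with trivial product.\<close>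

lemma card_torus_points:
  fixes a :: "nat \<Rightarrow> 'k::{field,finite}"
  assumes \<psi>: "nontrivial_add_char \<psi>" and r: "r > 0" and S: "finite S" "S \<noteq> {}"
    and m: "\<And>i. i \<in> S \<Longrightarrow> m i dvd CARD('k) - 1" and a: "\<And>i. i \<in> S \<Longrightarrow> a i \<noteq> 0"
  shows "of_nat (CARD('k) ^ r) * of_nat (card (torus_points a m S r)) =
    of_nat (CARD('k) ^ r - 1) ^ card S +
    of_nat (CARD('k) ^ r - 1) * (-1) ^ card S * (\<Sum>\<chi>\<in>char_tuples m S. omega \<psi> a S \<chi> ^ r)"
proof -
  let ?K = "ext_field r :: 'k alg_closure set"
  let ?P = "S \<rightarrow>\<^sub>E ?K - {0}"
  let ?X = "\<lambda>i. mult_chars_of_exponent (m i) :: ('k \<Rightarrow> complex) set"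
  let ?Q = "CARD('k) ^ r"
  let ?L = "\<lambda>x. \<Sum>i\<in>S. to_ac (a i) * x i ^ m i"
  let ?e = "ext_add_char \<psi> r"
  let ?t = "\<lambda>\<chi> i. - ((- cnj (\<chi> i (a i)) * gauss_sum \<psi> (\<chi> i)) ^ r)"
  have finK: "finite ?K" by (rule finite_ext_field[OF r])
  have finP: "finite ?P" using S finK by (intro finite_PiE) auto
  have L: "?L x \<in> ?K" if "x \<in> ?P" for x
    using that by (auto intro!: ext_field_sum ext_field_mult ext_field_power)
  have "of_nat ?Q * of_nat (card (torus_points a m S r)) = (\<Sum>x\<in>?P. if ?L x = 0 then of_nat ?Q else (0::complex))"
    by (simp add: torus_points_def sum.If_cases[OF finP] Int_def)
  also have "\<dots> = (\<Sum>x\<in>?P. \<Sum>y\<in>?K. ?e (y * ?L x))"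
    by (intro sum.cong refl) (simp add: sum_ext_add_char[OF \<psi> r L])
  also have "\<dots> = (\<Sum>y\<in>?K. \<Sum>x\<in>?P. ?e (y * ?L x))"
    by (rule sum.swap)
  also have "\<dots> = (\<Sum>y\<in>?K. \<Prod>i\<in>S. \<Sum>x\<in>?K - {0}. ?e (y * (to_ac (a i) * x ^ m i)))"
  proof (intro sum.cong refl)
    fix y assume y: "y \<in> ?K"
    have "(\<Prod>i\<in>S. \<Sum>x\<in>?K - {0}. ?e (y * (to_ac (a i) * x ^ m i)))
        = (\<Sum>x\<in>?P. \<Prod>i\<in>S. ?e (y * (to_ac (a i) * x i ^ m i)))"
      using S finK by (intro prod_sum_PiE) auto
    also have "\<dots> = (\<Sum>x\<in>?P. ?e (y * ?L x))"
      unfolding sum_distrib_left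
      using y by (intro sum.cong refl ext_add_char_sum[OF \<psi>, symmetric])
        (auto intro!: ext_field_mult ext_field_power)
    finally show "(\<Sum>x\<in>?P. ?e (y * ?L x)) = (\<Prod>i\<in>S. \<Sum>x\<in>?K - {0}. ?e (y * (to_ac (a i) * x ^ m i)))" ..
  qed
  also have "\<dots> = (\<Prod>i\<in>S. \<Sum>x\<in>?K - {0}. ?e (0 * (to_ac (a i) * x ^ m i))) +
      (\<Sum>y\<in>?K - {0}. \<Prod>i\<in>S. \<Sum>x\<in>?K - {0}. ?e (y * (to_ac (a i) * x ^ m i)))"
    by (rule sum.remove[OF finK]) simp
  also have "(\<Prod>i\<in>S. \<Sum>x\<in>?K - {0}. ?e (0 * (to_ac (a i) * x ^ m i))) = of_nat (?Q - 1) ^ card S"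
    by (simp add: ext_add_char_0[OF \<psi>] card_Diff_singleton card_ext_field[OF r])
  also have "(\<Sum>y\<in>?K - {0}. \<Prod>i\<in>S. \<Sum>x\<in>?K - {0}. ?e (y * (to_ac (a i) * x ^ m i)))
    = (\<Sum>y\<in>?K - {0}. \<Prod>i\<in>S. \<Sum>\<chi>\<in>?X i.
        cnj (ext_mult_char \<chi> r y) * - ((- cnj (\<chi> (a i)) * gauss_sum \<psi> \<chi>) ^ r))"
    by (intro sum.cong prod.cong refl sum_ext_add_char_power[OF \<psi> r m a]) auto
  also have "\<dots> = (\<Sum>y\<in>?K - {0}. \<Sum>\<chi>\<in>PiE S ?X. \<Prod>i\<in>S. cnj (ext_mult_char (\<chi> i) r y) * ?t \<chi> i)"
    using S m by (intro sum.cong refl prod_sum_PiE finite_mult_chars_of_exponent) auto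
  also have "\<dots> = (\<Sum>\<chi>\<in>PiE S ?X. \<Sum>y\<in>?K - {0}. \<Prod>i\<in>S. cnj (ext_mult_char (\<chi> i) r y) * ?t \<chi> i)"
    by (rule sum.swap)
  also have "\<dots> = (\<Sum>\<chi>\<in>PiE S ?X. if \<forall>u. u \<noteq> 0 \<longrightarrow> (\<Prod>i\<in>S. \<chi> i u) = 1
      then of_nat (?Q - 1) * (-1) ^ card S * omega \<psi> a S \<chi> ^ r else 0)"
  proof (intro sum.cong refl)
    fix \<chi> assume \<chi>: "\<chi> \<in> PiE S ?X"
    then have mc: "mult_char (\<chi> i)" if "i \<in> S" for i
      using that by (auto simp: PiE_iff mult_chars_of_exponent_def)
    \<comment> \<open>All dependence on \<open>y\<close> is collected in this single character, to
      which orthogonality applies. Nonemptiness of \<open>S\<close> gives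
      \<open>\<eta> 0 = 0\<close>.\<close>
    define \<eta> where "\<eta> = (\<lambda>u. \<Prod>i\<in>S. \<chi> i u)"
    obtain i0 where "i0 \<in> S" using S by auto
    have \<eta>: "mult_char \<eta>"
      unfolding mult_char_def \<eta>_def
      using S \<open>i0 \<in> S\<close> mc by (auto simp: mult_charD prod.distrib[symmetric] intro!: prod.cong)
    have t: "(\<Prod>i\<in>S. ?t \<chi> i) = (-1) ^ card S * omega \<psi> a S \<chi> ^ r"
    proof -
      have "(\<Prod>i\<in>S. ?t \<chi> i) = (\<Prod>i\<in>S. (-1) * (- cnj (\<chi> i (a i)) * gauss_sum \<psi> (\<chi> i)) ^ r)"
        by simp
      also have "\<dots> = (-1) ^ card S * (\<Prod>i\<in>S. (- cnj (\<chi> i (a i)) * gauss_sum \<psi> (\<chi> i)) ^ r)"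
        by (simp only: prod.distrib prod_constant)
      finally show ?thesis by (simp only: omega_def prod_power_distrib)
    qed
    have "(\<Sum>y\<in>?K - {0}. \<Prod>i\<in>S. cnj (ext_mult_char (\<chi> i) r y) * ?t \<chi> i) =
        (\<Sum>y\<in>?K - {0}. cnj (ext_mult_char \<eta> r y)) * (\<Prod>i\<in>S. ?t \<chi> i)"
      unfolding prod.distrib sum_distrib_right by (simp only: \<eta>_def ext_mult_char_def cnj_prod)
    also have "\<dots> = (if \<forall>u. u \<noteq> 0 \<longrightarrow> \<eta> u = 1 then of_nat (?Q - 1) else 0) * (\<Prod>i\<in>S. ?t \<chi> i)"
      by (simp only: sum_cnj_ext_mult_char[OF \<eta> r])
    also have "\<dots> = (if \<forall>u. u \<noteq> 0 \<longrightarrow> (\<Prod>i\<in>S. \<chi> i u) = 1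
        then of_nat (?Q - 1) * (-1) ^ card S * omega \<psi> a S \<chi> ^ r else 0)"
      unfolding t \<eta>_def by (simp only: mult.assoc if_distrib[where f = "\<lambda>z. z * _"] mult_zero_left)
    finally show "(\<Sum>y\<in>?K - {0}. \<Prod>i\<in>S. cnj (ext_mult_char (\<chi> i) r y) * ?t \<chi> i) =
        (if \<forall>u. u \<noteq> 0 \<longrightarrow> (\<Prod>i\<in>S. \<chi> i u) = 1
         then of_nat (?Q - 1) * (-1) ^ card S * omega \<psi> a S \<chi> ^ r else 0)" .
  qed
  also have "\<dots> = (\<Sum>\<chi>\<in>char_tuples m S. of_nat (?Q - 1) * (-1) ^ card S * omega \<psi> a S \<chi> ^ r)"
    unfolding char_tuples_eq
    using S m by (intro sum.inter_filter[symmetric] finite_PiE finite_mult_chars_of_exponent) auto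
  also have "\<dots> = of_nat (?Q - 1) * (-1) ^ card S * (\<Sum>\<chi>\<in>char_tuples m S. omega \<psi> a S \<chi> ^ r)"
    by (simp add: sum_distrib_left)
  finally show ?thesis .
qed

subsection \<open>Counting orbits\<close>

lemma power_gcd_eq_1_iff:
  fixes z :: "'a::idom"
  shows "z ^ gcd a b = 1 \<longleftrightarrow> z ^ a = 1 \<and> z ^ b = 1"
proof
  assume *: "z ^ gcd a b = 1"
  have "z ^ (gcd a b * (a div gcd a b)) = 1" "z ^ (gcd a b * (b div gcd a b)) = 1"
    using * by (simp_all only: power_mult power_one)
  then show "z ^ a = 1 \<and> z ^ b = 1" by simp
next
  assume *: "z ^ a = 1 \<and> z ^ b = 1"
  show "z ^ gcd a b = 1"
  proof (cases "a = 0")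
    case False
    then obtain x y where "a * x = b * y + gcd a b" using bezout_nat by blast
    then have "(z ^ a) ^ x = (z ^ b) ^ y * z ^ gcd a b" by (simp flip: power_mult power_add)
    then show ?thesis using * by simp
  qed (use * in simp)
qed

text \<open>Identifies the stabiliser of a point with support \<open>S\<close>: the scalars fixing
  all its nonzero coordinates are the roots of unity of order dividing
  \<open>weight_gcd w S\<close>.\<close>

lemma power_weight_gcd_eq_1_iff:
  fixes z :: "'a::idom"
  assumes "finite S"
  shows "z ^ weight_gcd w S = 1 \<longleftrightarrow> (\<forall>i\<in>S. z ^ w i = 1)"
  using assms by (induction S rule: finite_induct) (simp_all add: weight_gcd_def power_gcd_eq_1_iff)

lemma weight_gcd_dvd: "i \<in> S \<Longrightarrow> weight_gcd w S dvd w i"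
  by (simp add: weight_gcd_def)

section \<open>Strata by support and the orbits in them\<close>

definition cone_stratum ::
    "nat \<Rightarrow> (nat \<Rightarrow> 'k::{field,finite}) \<Rightarrow> (nat \<Rightarrow> nat) \<Rightarrow> nat \<Rightarrow> nat set \<Rightarrow> (nat \<Rightarrow> 'k alg_closure) set" where
  "cone_stratum n a m r S = {x \<in> cone_points n a m r. {i. i \<le> n \<and> x i \<noteq> 0} = S}"

text \<open>Forget the zero coordinates, or fill them in again. As the exponents are positive, these
  coordinates contribute nothing to the form.\<close>

lemma card_cone_stratum:
  fixes a :: "nat \<Rightarrow> 'k::{field,finite}"
  assumes S: "S \<subseteq> {..n}" "S \<noteq> {}" and m: "\<And>i. i \<le> n \<Longrightarrow> m i > 0"
  shows "card (cone_stratum n a m r S) = card (torus_points a m S r)"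
proof -
  have form: "(\<Sum>i\<le>n. to_ac (a i) * x i ^ m i) = (\<Sum>i\<in>S. to_ac (a i) * x i ^ m i)"
    if "\<And>i. i \<in> {..n} - S \<Longrightarrow> x i = 0" for x :: "nat \<Rightarrow> 'k alg_closure"
  proof (intro sum.mono_neutral_right ballI)
    fix i assume "i \<in> {..n} - S"
    then show "to_ac (a i) * x i ^ m i = 0" using that[of i] m[of i] by simp
  qed (use S in auto)
  have "bij_betw (\<lambda>x. restrict x S) (cone_stratum n a m r S) (torus_points a m S r)"
  proof (rule bij_betw_byWitness[where f' = "\<lambda>x. \<lambda>i\<in>{..n}. if i \<in> S then x i else 0"])
    show "\<forall>x\<in>cone_stratum n a m r S. (\<lambda>i\<in>{..n}. if i \<in> S then restrict x S i else 0) = x"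
      using S by (auto simp: cone_stratum_def cone_points_def fun_eq_iff restrict_def PiE_iff extensional_def)
    show "\<forall>x\<in>torus_points a m S r. restrict (\<lambda>i\<in>{..n}. if i \<in> S then x i else 0) S = x"
      using S by (auto simp: torus_points_def fun_eq_iff restrict_def PiE_iff extensional_def)
    show "(\<lambda>x. restrict x S) ` cone_stratum n a m r S \<subseteq> torus_points a m S r"
    proof
      fix y assume "y \<in> (\<lambda>x. restrict x S) ` cone_stratum n a m r S"
      then obtain x where x: "x \<in> cone_stratum n a m r S" and y: "y = restrict x S" by auto
      have "(\<Sum>i\<in>S. to_ac (a i) * x i ^ m i) = 0"
        using x form[of x] by (auto simp: cone_stratum_def cone_points_def diag_form_def)
      then show "y \<in> torus_points a m S r"
        using x S unfolding y by (auto simp: cone_stratum_def cone_points_def torus_points_def)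
    qed
    show "(\<lambda>x. \<lambda>i\<in>{..n}. if i \<in> S then x i else 0) ` torus_points a m S r \<subseteq> cone_stratum n a m r S"
    proof
      fix y assume "y \<in> (\<lambda>x. \<lambda>i\<in>{..n}. if i \<in> S then x i else 0) ` torus_points a m S r"
      then obtain x where x: "x \<in> torus_points a m S r"
        and y: "y = (\<lambda>i\<in>{..n}. if i \<in> S then x i else 0)" by auto
      have yi: "y i = x i" "y i \<in> ext_field r" "y i \<noteq> 0" if "i \<in> S" for i
        using that x S by (auto simp: y torus_points_def)
      have y0: "y i = 0" if "i \<in> {..n} - S" for i using that by (simp add: y)
      have "(\<Sum>i\<le>n. to_ac (a i) * y i ^ m i) = (\<Sum>i\<in>S. to_ac (a i) * y i ^ m i)"
        by (rule form) (rule y0)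
      also have "\<dots> = 0" using x by (simp add: yi torus_points_def)
      finally have "diag_form n a m y = 0" by (simp add: diag_form_def)
      moreover have "y \<in> {..n} \<rightarrow>\<^sub>E ext_field r"
        using x S by (auto simp: y torus_points_def PiE_iff)
      moreover have "{i. i \<le> n \<and> y i \<noteq> 0} = S"
        using S yi(3) y0 by auto
      moreover obtain i where "i \<in> S" using S by auto
      ultimately show "y \<in> cone_stratum n a m r S"
        using yi(3)[of i] S by (auto simp: cone_stratum_def cone_points_def)
    qed
  qed
  then show ?thesis by (rule bij_betw_same_card)
qed

lemma finite_cone_points:
  assumes "r > 0"
  shows "finite (cone_points n a m r)"
  unfolding cone_points_def
  by (rule finite_subset[OF _ finite_PiE[of "{..n}" "\<lambda>_. ext_field r"]]) (auto simp: finite_ext_field assms)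

lemma weighted_scale_weighted_scale:
  "weighted_scale n w c (weighted_scale n w c' x) = weighted_scale n w (c * c') x"
  by (auto simp: weighted_scale_def fun_eq_iff power_mult_distrib)

lemma weighted_scale_1: "x \<in> extensional {..n} \<Longrightarrow> weighted_scale n w 1 x = x"
  by (auto simp: weighted_scale_def fun_eq_iff extensional_def)

text \<open>The form is weighted homogeneous: \<open>m i * w i = d\<close> makes every monomial
  scale by the same \<open>c ^ d\<close>, while nonzero \<open>c\<close> preserves the
  support.\<close>

lemma weighted_scale_cone_stratum:
  fixes a :: "nat \<Rightarrow> 'k::{field,finite}"
  assumes deg: "\<And>i. i \<le> n \<Longrightarrow> m i * w i = d"
    and c: "c \<in> ext_field r - {0}" and x: "x \<in> cone_stratum n a m r S"
  shows "weighted_scale n w c x \<in> cone_stratum n a m r S"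
proof -
  let ?y = "weighted_scale n w c x"
  have "diag_form n a m ?y = (\<Sum>i\<le>n. c ^ d * (to_ac (a i) * x i ^ m i))"
    unfolding diag_form_def weighted_scale_def
    by (intro sum.cong refl) (auto simp: power_mult_distrib mult_ac deg simp flip: power_mult)
  also have "\<dots> = c ^ d * diag_form n a m x"
    by (simp add: diag_form_def sum_distrib_left)
  finally have "diag_form n a m ?y = 0" using x by (simp add: cone_stratum_def cone_points_def)
  moreover have "?y i \<noteq> 0 \<longleftrightarrow> x i \<noteq> 0" if "i \<le> n" for i using that c by (simp add: weighted_scale_def)
  moreover have "?y \<in> {..n} \<rightarrow>\<^sub>E ext_field r"
    using x c by (auto simp: weighted_scale_def cone_stratum_def cone_points_def intro!: ext_field_mult ext_field_power)
  ultimately show ?thesis using x by (auto simp: cone_stratum_def cone_points_def)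
qed

lemma self_mem_weighted_orbit:
  assumes "x \<in> cone_stratum n a m r S"
  shows "x \<in> weighted_orbit n w r x"
proof -
  have "x = weighted_scale n w 1 x"
    using assms by (subst weighted_scale_1) (auto simp: cone_stratum_def cone_points_def PiE_iff)
  then show ?thesis by (auto simp: weighted_orbit_def)
qed

lemma weighted_orbit_weighted_scale:
  fixes c :: "'k::{field,finite} alg_closure"
  assumes "c \<in> ext_field r - {0}"
  shows "weighted_orbit n w r (weighted_scale n w c x) = weighted_orbit n w r x"
proof -
  have "(\<lambda>b. b * c) ` (ext_field r - {0}) = ext_field r - {0}"
  proof (intro equalityI subsetI)
    fix b :: "'k alg_closure" assume "b \<in> ext_field r - {0}"
    then have "b / c \<in> ext_field r - {0}" using assms by (auto intro: ext_field_divide)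
    then have "b / c * c \<in> (\<lambda>b. b * c) ` (ext_field r - {0})" by (rule imageI)
    then show "b \<in> (\<lambda>b. b * c) ` (ext_field r - {0})" using assms by simp
  qed (use assms in \<open>auto intro: ext_field_mult\<close>)
  then have "weighted_orbit n w r x = (\<lambda>b. weighted_scale n w b x) ` (\<lambda>b. b * c) ` (ext_field r - {0})"
    by (simp add: weighted_orbit_def)
  then show ?thesis
    by (simp add: weighted_orbit_def weighted_scale_weighted_scale image_image)
qed

text \<open>Orbit-stabiliser: the fibres of \<open>c \<mapsto> weighted_scale n w c x\<close> are
  cosets of the roots of unity of order dividing \<open>weight_gcd w S\<close>. All these roots lie
  in the extension since that order divides \<open>CARD('k) - 1\<close>.\<close>

lemma card_weighted_orbit:
  fixes a :: "nat \<Rightarrow> 'k::{field,finite}"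
  assumes r: "r > 0" and S: "S \<subseteq> {..n}" and k: "weight_gcd w S dvd CARD('k) - 1"
    and x: "x \<in> cone_stratum n a m r S"
  shows "card (weighted_orbit n w r x) * weight_gcd w S = CARD('k) ^ r - 1"
proof -
  let ?K = "ext_field r - {0 :: 'k alg_closure}"
  let ?k = "weight_gcd w S"
  have finS: "finite S" using S finite_subset by blast
  have supp: "S = {i. i \<le> n \<and> x i \<noteq> 0}" using x by (simp add: cone_stratum_def)
  have fibre: "card {b\<in>?K. weighted_scale n w b x = weighted_scale n w c x} = ?k" if c: "c \<in> ?K" for c
  proof -
    have eq: "weighted_scale n w b x = weighted_scale n w c x \<longleftrightarrow> (b / c) ^ ?k = 1" for b
    proof -
      have "weighted_scale n w b x = weighted_scale n w c x \<longleftrightarrow> (\<forall>i\<le>n. b ^ w i * x i = c ^ w i * x i)"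
        by (auto simp: weighted_scale_def fun_eq_iff restrict_def)
      also have "\<dots> \<longleftrightarrow> (\<forall>i\<in>S. (b / c) ^ w i = 1)"
        using c by (auto simp: supp power_divide divide_eq_1_iff)
      finally show ?thesis using power_weight_gcd_eq_1_iff[OF finS] by blast
    qed
    have "card {b\<in>?K. weighted_scale n w b x = weighted_scale n w c x} = card {z\<in>?K. z ^ ?k = 1}"
    proof (rule bij_betw_same_card[of "\<lambda>b. b / c"])
      show "bij_betw (\<lambda>b. b / c) {b\<in>?K. weighted_scale n w b x = weighted_scale n w c x} {z\<in>?K. z ^ ?k = 1}"
        using c unfolding eq
        by (intro bij_betw_byWitness[where f' = "\<lambda>z. z * c"])
           (auto intro: ext_field_divide ext_field_mult)
    qed
    also have "\<dots> = ?k" using card_nth_roots_ext_field[OF k, of 1 r] by simp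
    finally show ?thesis .
  qed
  have finK: "finite ?K" by (simp add: finite_ext_field r)
  have "card ?K = (\<Sum>b\<in>?K. 1)" by simp
  also have "\<dots> = (\<Sum>y\<in>weighted_orbit n w r x. \<Sum>b\<in>{b\<in>?K. weighted_scale n w b x = y}. 1)"
    unfolding weighted_orbit_def by (rule sum.image_gen[OF finK])
  also have "\<dots> = (\<Sum>y\<in>weighted_orbit n w r x. ?k)"
  proof (intro sum.cong refl)
    fix y assume "y \<in> weighted_orbit n w r x"
    then obtain c where c: "c \<in> ?K" and y: "y = weighted_scale n w c x"
      by (auto simp: weighted_orbit_def)
    have "(\<Sum>b\<in>{b\<in>?K. weighted_scale n w b x = y}. 1) = card {b\<in>?K. weighted_scale n w b x = y}"
      by (rule card_eq_sum[symmetric])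
    then show "(\<Sum>b\<in>{b\<in>?K. weighted_scale n w b x = y}. 1) = ?k"
      by (simp only: y fibre[OF c])
  qed
  finally show ?thesis by (simp add: card_Diff_singleton card_ext_field r)
qed

text \<open>The orbits partition the stratum into pieces of the common size given by
  orbit-stabiliser.\<close>

lemma card_orbits_cone_stratum:
  fixes a :: "nat \<Rightarrow> 'k::{field,finite}"
  assumes r: "r > 0" and S: "S \<subseteq> {..n}" and k: "weight_gcd w S dvd CARD('k) - 1"
    and deg: "\<And>i. i \<le> n \<Longrightarrow> m i * w i = d"
  shows "card (weighted_orbit n w r ` cone_stratum n a m r S) * (CARD('k) ^ r - 1)
    = weight_gcd w S * card (cone_stratum n a m r S)"
proof -
  let ?C = "cone_stratum n a m r S"
  let ?O = "weighted_orbit n w r"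
  let ?k = "weight_gcd w S"
  have k0: "?k > 0" using k finite_field_card_gt_1[where 'k='k] by (intro Nat.gr0I) auto
  have finC: "finite ?C" by (rule finite_subset[OF _ finite_cone_points[OF r]]) (auto simp: cone_stratum_def)
  have sub: "y \<in> ?C" if "y \<in> ?O x" "x \<in> ?C" for x y
    using that weighted_scale_cone_stratum[of n m w d _ r x a S] deg
    by (auto simp: weighted_orbit_def)
  have U: "\<Union> (?O ` ?C) = ?C"
  proof (intro equalityI subsetI)
    fix y assume "y \<in> \<Union> (?O ` ?C)"
    then obtain x where x: "x \<in> ?C" "y \<in> ?O x" by auto
    show "y \<in> ?C" by (rule sub[OF x(2,1)])
  next
    fix y assume y: "y \<in> ?C"
    show "y \<in> \<Union> (?O ` ?C)" using y self_mem_weighted_orbit[OF y] by auto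
  qed
  have "(CARD('k) ^ r - 1) div ?k * card (?O ` ?C) = card (\<Union> (?O ` ?C))"
  proof (rule card_partition)
    show "finite (?O ` ?C)" "finite (\<Union> (?O ` ?C))" using finC by (auto simp only: U finite_imageI)
    show "card c = (CARD('k) ^ r - 1) div ?k" if cO: "c \<in> ?O ` ?C" for c
    proof -
      obtain x where x: "x \<in> ?C" and c: "c = ?O x" using cO by auto
      show ?thesis using card_weighted_orbit[OF r S k x] k0 unfolding c
        by (metis div_mult_self_is_m)
    qed
    show "c1 \<inter> c2 = {}" if c12: "c1 \<in> ?O ` ?C" "c2 \<in> ?O ` ?C" "c1 \<noteq> c2" for c1 c2
    proof (rule ccontr)
      obtain x1 x2 where x: "c1 = ?O x1" "c2 = ?O x2" using c12 by auto
      assume "c1 \<inter> c2 \<noteq> {}"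
      then obtain y where "y \<in> ?O x1" "y \<in> ?O x2" using x by auto
      moreover have "?O y = ?O z" if "y \<in> ?O z" for z
      proof -
        obtain c where "c \<in> ext_field r - {0}" "y = weighted_scale n w c z"
          using \<open>y \<in> ?O z\<close> by (auto simp: weighted_orbit_def)
        then show ?thesis by (simp only: weighted_orbit_weighted_scale)
      qed
      ultimately have "?O y = ?O x1" "?O y = ?O x2" by auto
      then show False using c12 x by simp
    qed
  qed
  moreover have "?k dvd CARD('k) ^ r - 1"
    using k card_minus_1_dvd[where 'k='k] dvd_trans by blast
  ultimately show ?thesis
    unfolding U by (metis dvd_mult_div_cancel mult.assoc mult.commute)
qed

text \<open>Scaling preserves supports, so orbits from different strata are distinct and the counts
  add.\<close>

lemma orbit_count_eq:
  fixes a :: "nat \<Rightarrow> 'k::{field,finite}"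
  assumes r: "r > 0" and w: "\<And>i. i \<le> n \<Longrightarrow> w i dvd CARD('k) - 1"
    and deg: "\<And>i. i \<le> n \<Longrightarrow> m i * w i = d" and m: "\<And>i. i \<le> n \<Longrightarrow> m i > 0"
  shows "orbit_count n w a m r * (CARD('k) ^ r - 1)
    = (\<Sum>S\<in>Pow {..n} - {{}}. weight_gcd w S * card (torus_points a m S r))"
proof -
  let ?O = "weighted_orbit n w r :: (nat \<Rightarrow> 'k alg_closure) \<Rightarrow> _"
  let ?C = "cone_stratum n a m r"
  have fin: "finite (?C S)" for S
    by (rule finite_subset[OF _ finite_cone_points[OF r]]) (auto simp: cone_stratum_def)
  have "cone_points n a m r = (\<Union>S\<in>Pow {..n} - {{}}. ?C S)"
    by (auto simp: cone_stratum_def cone_points_def)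
  then have "orbit_count n w a m r = card (\<Union>S\<in>Pow {..n} - {{}}. ?O ` ?C S)"
    by (simp add: orbit_count_def image_UN)
  also have "\<dots> = (\<Sum>S\<in>Pow {..n} - {{}}. card (?O ` ?C S))"
  proof (intro card_UN_disjoint ballI impI)
    fix S S' :: "nat set" assume "S \<noteq> S'"
    show "?O ` ?C S \<inter> ?O ` ?C S' = {}"
    proof (rule ccontr)
      assume "?O ` ?C S \<inter> ?O ` ?C S' \<noteq> {}"
      then obtain x y where xy: "x \<in> ?C S" "y \<in> ?C S'" "?O x = ?O y" by auto
      then have "x \<in> ?O y" using self_mem_weighted_orbit[OF xy(1), of w] by simp
      then have "x \<in> ?C S'"
        using weighted_scale_cone_stratum[of n m w d _ r y a S'] deg xy(2)
        by (auto simp: weighted_orbit_def)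
      then show False using xy \<open>S \<noteq> S'\<close> by (simp add: cone_stratum_def)
    qed
  qed (use fin in auto)
  finally have "orbit_count n w a m r * (CARD('k) ^ r - 1)
      = (\<Sum>S\<in>Pow {..n} - {{}}. card (?O ` ?C S) * (CARD('k) ^ r - 1))"
    by (simp only: sum_distrib_right)
  also have "\<dots> = (\<Sum>S\<in>Pow {..n} - {{}}. weight_gcd w S * card (torus_points a m S r))"
  proof (intro sum.cong refl)
    fix S assume S: "S \<in> Pow {..n} - {{}}"
    then obtain i where "i \<in> S" "i \<le> n" by auto
    then have k: "weight_gcd w S dvd CARD('k) - 1" using w weight_gcd_dvd dvd_trans by blast
    show "card (?O ` ?C S) * (CARD('k) ^ r - 1) = weight_gcd w S * card (torus_points a m S r)"
      using S card_orbits_cone_stratum[OF r _ k, of n m d a] deg card_cone_stratum[of S n m a r] m by auto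
  qed
  finally show ?thesis .
qed

text \<open>Dividing the torus count by \<open>Q\<close> and \<open>Q - 1\<close> leaves
  \<open>(Q - 1) ^ (card S - 1) / Q\<close> plus the sum of omega powers over \<open>Q\<close>, up
  to sign. The binomial theorem makes every term an integer times an \<open>r\<close>-th power, the
  shape needed for exponentiation.\<close>

lemma orbit_count_formula:
  fixes a :: "nat \<Rightarrow> 'k::{field,finite}"
  assumes \<psi>: "nontrivial_add_char \<psi>" and r: "r > 0"
    and w: "\<And>i. i \<le> n \<Longrightarrow> w i dvd CARD('k) - 1" and md: "\<And>i. i \<le> n \<Longrightarrow> m i dvd CARD('k) - 1"
    and deg: "\<And>i. i \<le> n \<Longrightarrow> m i * w i = d" and m: "\<And>i. i \<le> n \<Longrightarrow> m i > 0"
    and a: "\<And>i. i \<le> n \<Longrightarrow> a i \<noteq> 0"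
  shows "of_nat (orbit_count n w a m r) = (\<Sum>S\<in>Pow {..n} - {{}}.
    (\<Sum>j = 0..card S - 1. of_int ((-1) ^ (card S - 1 - j) * int ((card S - 1) choose j) * int (weight_gcd w S))
        * (of_nat CARD('k) powi (int j - 1)) ^ r) +
    (\<Sum>\<chi>\<in>char_tuples m S. of_int ((-1) ^ card S * int (weight_gcd w S))
        * (inverse (of_nat CARD('k)) * omega \<psi> a S \<chi>) ^ r) :: complex)"
proof -
  define Q :: complex where "Q = of_nat CARD('k) ^ r"
  have q1: "CARD('k) > 1" by (rule finite_field_card_gt_1)
  have "CARD('k) ^ r > 1" using q1 r by (rule one_less_power)
  moreover have Qn: "Q = of_nat (CARD('k) ^ r)" by (simp add: Q_def)
  ultimately have QQ: "of_nat (CARD('k) ^ r - 1) = Q - 1" and "Q - 1 \<noteq> 0" and "Q \<noteq> 0"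
  proof -
    assume gt: "CARD('k) ^ r > 1"
    then show QQ: "of_nat (CARD('k) ^ r - 1) = Q - 1" unfolding Qn by (simp only: of_nat_diff of_nat_1)
    show "Q - 1 \<noteq> 0" unfolding QQ[symmetric] of_nat_eq_0_iff using gt by linarith
    show "Q \<noteq> 0" unfolding Qn of_nat_eq_0_iff using gt by linarith
  qed
  then have Q0: "Q \<noteq> 0" and Q1: "Q - 1 \<noteq> 0" by auto
  have "of_nat (orbit_count n w a m r) * (Q - 1) =
      (\<Sum>S\<in>Pow {..n} - {{}}. of_nat (weight_gcd w S) * of_nat (card (torus_points a m S r)))"
    using arg_cong[OF orbit_count_eq[where a = a and n = n and w = w and m = m and d = d, OF r w deg m], where f = "of_nat :: nat \<Rightarrow> complex"]
    by (simp only: of_nat_mult of_nat_sum QQ)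
  then have "of_nat (orbit_count n w a m r) =
      (\<Sum>S\<in>Pow {..n} - {{}}. of_nat (weight_gcd w S) * of_nat (card (torus_points a m S r)) / (Q - 1))"
    using Q1 by (simp only: sum_divide_distrib[symmetric]) (simp add: eq_divide_eq)
  also have "\<dots> = (\<Sum>S\<in>Pow {..n} - {{}}.
    (\<Sum>j = 0..card S - 1. of_int ((-1) ^ (card S - 1 - j) * int ((card S - 1) choose j) * int (weight_gcd w S))
        * (of_nat CARD('k) powi (int j - 1)) ^ r) +
    (\<Sum>\<chi>\<in>char_tuples m S. of_int ((-1) ^ card S * int (weight_gcd w S))
        * (inverse (of_nat CARD('k)) * omega \<psi> a S \<chi>) ^ r))"
  proof (intro sum.cong refl)
    fix S assume "S \<in> Pow {..n} - {{}}"
    then have S: "S \<subseteq> {..n}" "S \<noteq> {}" by auto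
    then have finS: "finite S" using finite_subset by blast
    obtain s where s: "card S = Suc s" using S finS by (metis card_gt_0_iff gr0_conv_Suc)
    let ?W = "\<Sum>\<chi>\<in>char_tuples m S. omega \<psi> a S \<chi> ^ r"
    let ?k = "of_nat (weight_gcd w S) :: complex"
    have N: "Q * of_nat (card (torus_points a m S r)) = (Q - 1) ^ Suc s + (Q - 1) * (-1) ^ card S * ?W"
      using card_torus_points[OF \<psi> r finS S(2), of m a] S md a
      by (auto simp only: QQ s Q_def of_nat_power)
    have "?k * of_nat (card (torus_points a m S r)) / (Q - 1) = ?k * (Q * of_nat (card (torus_points a m S r))) / (Q * (Q - 1))"
      using Q0 by simp
    also have "\<dots> = ?k * ((Q - 1) ^ s) / Q + ?k * (-1) ^ card S * ?W / Q"
      unfolding N using Q0 Q1 by (simp add: divide_simps) (simp add: algebra_simps)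
    also have "?k * ((Q - 1) ^ s) / Q = (\<Sum>j = 0..card S - 1.
        of_int ((-1) ^ (card S - 1 - j) * int ((card S - 1) choose j) * int (weight_gcd w S))
        * (of_nat CARD('k) powi (int j - 1)) ^ r)"
    proof -
      \<comment> \<open>The integer exponent matters at \<open>j = 0\<close>, where the term is the
        inverse of \<open>Q\<close>.\<close>
      have pw: "(of_nat CARD('k) powi (int j - 1)) ^ r = Q ^ j / Q" for j
        using q1 by (simp add: power_int_diff Q_def power_divide mult.commute flip: power_mult)
      have "(Q - 1) ^ s = (\<Sum>j\<le>s. of_nat (s choose j) * Q ^ j * (-1) ^ (s - j))"
        using binomial_ring[of Q "-1" s] by simp
      then have "?k * ((Q - 1) ^ s) / Q = (\<Sum>j\<le>s. ?k * (of_nat (s choose j) * Q ^ j * (-1) ^ (s - j)) / Q)"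
        by (simp only: sum_distrib_left sum_divide_distrib)
      then show ?thesis by (simp add: s pw atLeast0AtMost mult_ac)
    qed
    also have "?k * (-1) ^ card S * ?W / Q = (\<Sum>\<chi>\<in>char_tuples m S. of_int ((-1) ^ card S * int (weight_gcd w S))
        * (inverse (of_nat CARD('k)) * omega \<psi> a S \<chi>) ^ r)"
      by (simp add: sum_distrib_left sum_divide_distrib Q_def power_mult_distrib power_inverse divide_inverse mult_ac)
    finally show "?k * of_nat (card (torus_points a m S r)) / (Q - 1) =
      (\<Sum>j = 0..card S - 1. of_int ((-1) ^ (card S - 1 - j) * int ((card S - 1) choose j) * int (weight_gcd w S))
        * (of_nat CARD('k) powi (int j - 1)) ^ r) +
      (\<Sum>\<chi>\<in>char_tuples m S. of_int ((-1) ^ card S * int (weight_gcd w S))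
        * (inverse (of_nat CARD('k)) * omega \<psi> a S \<chi>) ^ r)" .
  qed
  finally show ?thesis .
qed

subsection \<open>Exponentials of power series\<close>

text \<open>Uniqueness for the differential equation \<open>A' = f' * A\<close>: the product of a
  solution with the exponential of \<open>- f\<close> has derivative zero. Applied to both
  \<open>A\<close> and the exponential of \<open>f\<close>, this identifies the two.\<close>

lemma fps_exp_compose_eqI:
  fixes f A :: "complex fps"
  assumes f0: "fps_nth f 0 = 0" and A: "fps_deriv A = fps_deriv f * A" "fps_nth A 0 = 1"
  shows "A = fps_compose (fps_exp 1) f"
proof -
  let ?E = "fps_compose (fps_exp 1)"
  have const: "B * ?E (- f) = 1" if B: "fps_deriv B = fps_deriv f * B" "fps_nth B 0 = 1" for B
  proof -
    have "fps_deriv (B * ?E (- f)) = 0"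
      using f0 by (simp add: B fps_compose_deriv algebra_simps)
    then have "B * ?E (- f) = fps_const (fps_nth (B * ?E (- f)) 0)" by (simp only: fps_deriv_eq_0_iff)
    then show ?thesis using B by simp
  qed
  have "fps_deriv (?E f) = fps_deriv f * ?E f"
    using f0 by (simp add: fps_compose_deriv mult.commute)
  then have E: "?E f * ?E (- f) = 1" by (intro const) auto
  have "A = A * (?E f * ?E (- f))" by (simp only: E mult_1_right)
  also have "\<dots> = (A * ?E (- f)) * ?E f" by (simp only: mult_ac)
  also have "A * ?E (- f) = 1" by (intro const A)
  finally show ?thesis by simp
qed

lemma fps_exp_compose_add:
  fixes f g :: "complex fps"
  assumes "fps_nth f 0 = 0" "fps_nth g 0 = 0"
  shows "fps_compose (fps_exp 1) (f + g) = fps_compose (fps_exp 1) f * fps_compose (fps_exp 1) g"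
  by (rule fps_exp_compose_eqI[symmetric]) (use assms in \<open>auto simp: fps_compose_deriv algebra_simps\<close>)

lemma fps_exp_compose_sum:
  fixes f :: "'b \<Rightarrow> complex fps"
  assumes "\<And>i. i \<in> A \<Longrightarrow> fps_nth (f i) 0 = 0"
  shows "fps_compose (fps_exp 1) (\<Sum>i\<in>A. f i) = (\<Prod>i\<in>A. fps_compose (fps_exp 1) (f i))"
  using assms
proof (induction A rule: infinite_finite_induct)
  case (insert i A)
  then show ?case by (simp add: fps_exp_compose_add fps_sum_nth)
qed (simp_all add: fps_compose_0_right)

section \<open>Exponentials of logarithms of linear factors\<close>

text \<open>The series of \<open>- log (1 - c X)\<close>.\<close>

definition fps_power_log :: "complex \<Rightarrow> complex fps" where
  "fps_power_log c = Abs_fps (\<lambda>r. if r = 0 then 0 else c ^ r / of_nat r)"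

lemma fps_deriv_power_log: "fps_deriv (fps_power_log c) * (1 - fps_const c * fps_X) = fps_const c"
proof (rule fps_ext)
  fix i
  show "fps_nth (fps_deriv (fps_power_log c) * (1 - fps_const c * fps_X)) i = fps_nth (fps_const c) i"
  proof (cases i)
    case (Suc j)
    have "fps_deriv (fps_power_log c) * (1 - fps_const c * fps_X)
        = fps_deriv (fps_power_log c) - fps_const c * (fps_X * fps_deriv (fps_power_log c))"
      by (simp only: right_diff_distrib mult_1_right mult_1_left mult_ac)
    then have "fps_nth (fps_deriv (fps_power_log c) * (1 - fps_const c * fps_X)) i
        = fps_nth (fps_deriv (fps_power_log c)) i - c * fps_nth (fps_deriv (fps_power_log c)) j"
      by (simp add: Suc)
    also have "\<dots> = 0"
      using Suc by (simp add: fps_power_log_def del: of_nat_Suc)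
    finally show ?thesis using Suc by simp
  qed (simp add: fps_power_log_def)
qed

lemma fps_exp_compose_power_log:
  "fps_compose (fps_exp 1) (fps_power_log c) = inverse (1 - fps_const c * fps_X)"
proof -
  let ?u = "1 - fps_const c * fps_X :: complex fps"
  have u: "inverse ?u * ?u = 1" by (rule inverse_mult_eq_1) simp
  have "fps_deriv (inverse ?u) = - fps_deriv ?u * (inverse ?u)\<^sup>2"
    by (rule fps_inverse_deriv) simp
  also have "\<dots> = fps_const c * inverse ?u * inverse ?u"
    by (simp add: power2_eq_square mult_ac)
  also have "\<dots> = fps_deriv (fps_power_log c) * ?u * inverse ?u * inverse ?u"
    by (simp only: fps_deriv_power_log)
  also have "\<dots> = fps_deriv (fps_power_log c) * (inverse ?u * ?u) * inverse ?u"
    by (simp only: mult_ac)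
  also have "\<dots> = fps_deriv (fps_power_log c) * inverse ?u" by (simp only: u mult_1_right)
  finally show ?thesis
    by (intro fps_exp_compose_eqI[symmetric]) (simp_all add: fps_power_log_def)
qed

text \<open>Natural multiples follow from additivity; a negative multiple is the inverse of the
  opposite one, because the two logarithms add up to zero.\<close>

lemma fps_exp_compose_int_power_log:
  "fps_compose (fps_exp 1) (of_int k * fps_power_log c) = (1 - fps_const c * fps_X) powi (- k)"
proof -
  let ?u = "1 - fps_const c * fps_X :: complex fps"
  let ?E = "fps_compose (fps_exp 1) :: complex fps \<Rightarrow> complex fps"
  let ?l = "fps_power_log c"
  have l0: "fps_nth (of_nat n * ?l) 0 = 0" for n by (simp add: fps_power_log_def)
  have u: "inverse ?u * ?u = 1" by (rule inverse_mult_eq_1) simp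
  have nat: "?E (of_nat n * ?l) = inverse ?u ^ n" for n
  proof (induction n)
    case (Suc n)
    have "of_nat (Suc n) * ?l = ?l + of_nat n * ?l" by (simp add: algebra_simps)
    then have "?E (of_nat (Suc n) * ?l) = ?E ?l * ?E (of_nat n * ?l)"
      using l0[of n] l0[of 1] by (simp only: fps_exp_compose_add mult_1 of_nat_1)
    then show ?case by (simp add: Suc fps_exp_compose_power_log)
  qed simp
  show ?thesis
  proof (cases "k \<ge> 0")
    case True
    then obtain n where k: "k = int n" by (metis nonneg_int_cases)
    show ?thesis by (cases "n = 0") (simp_all add: k nat power_int_def)
  next
    case False
    then obtain n where k: "k = - int n" by (metis nonpos_int_cases linorder_linear)
    have "?E (of_int k * ?l) * ?E (of_nat n * ?l) = ?E (of_int k * ?l + of_nat n * ?l)"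
      using l0[of n] by (intro fps_exp_compose_add[symmetric]) (simp_all add: k fps_power_log_def)
    also have "of_int k * ?l + of_nat n * ?l = 0" by (simp add: k)
    finally have "?E (of_int k * ?l) * inverse ?u ^ n = 1" by (simp add: nat fps_compose_0_right)
    then have "?E (of_int k * ?l) * (inverse ?u ^ n * ?u ^ n) = ?u ^ n" by (simp only: mult.assoc[symmetric] mult_1)
    then have "?E (of_int k * ?l) = ?u ^ n" by (simp only: power_mult_distrib[symmetric] u power_one mult_1_right)
    then show ?thesis by (simp add: k power_int_def)
  qed
qed

section \<open>Rationality and location of zeros and poles\<close>

text \<open>The fraction need not be in lowest terms, which makes the property closed under products
  without tracking cancellation. Roots of numerator and denominator must be reciprocals of elements
  of \<open>C\<close>.\<close>

definition linear_fraction :: "complex set \<Rightarrow> complex fps \<Rightarrow> bool" where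
  "linear_fraction C Z \<longleftrightarrow> (\<exists>A B. poly B 0 \<noteq> 0 \<and> Z * fps_of_poly B = fps_of_poly A \<and>
     (\<forall>z. poly A z = 0 \<or> poly B z = 0 \<longrightarrow> (\<exists>c\<in>C. c * z = 1)))"

lemma linear_fraction_1: "linear_fraction C 1"
  unfolding linear_fraction_def by (intro exI[of _ 1]) auto

lemma linear_fraction_mult:
  assumes "linear_fraction C Y" "linear_fraction C Z"
  shows "linear_fraction C (Y * Z)"
proof -
  obtain A B where Y: "poly B 0 \<noteq> 0" "Y * fps_of_poly B = fps_of_poly A"
      "\<And>z. poly A z = 0 \<or> poly B z = 0 \<Longrightarrow> \<exists>c\<in>C. c * z = 1"
    using assms(1) by (auto simp: linear_fraction_def)
  obtain A' B' where Z: "poly B' 0 \<noteq> 0" "Z * fps_of_poly B' = fps_of_poly A'"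
      "\<And>z. poly A' z = 0 \<or> poly B' z = 0 \<Longrightarrow> \<exists>c\<in>C. c * z = 1"
    using assms(2) by (auto simp: linear_fraction_def)
  have "Y * Z * fps_of_poly (B * B') = fps_of_poly (A * A')"
    by (simp only: fps_of_poly_mult Y(2)[symmetric] Z(2)[symmetric] mult_ac)
  moreover have "poly (B * B') 0 \<noteq> 0" using Y(1) Z(1) by simp
  moreover have "\<exists>c\<in>C. c * z = 1" if "poly (A * A') z = 0 \<or> poly (B * B') z = 0" for z
    using that Y(3)[of z] Z(3)[of z] by auto
  ultimately show ?thesis unfolding linear_fraction_def by blast
qed

lemma linear_fraction_prod:
  assumes "\<And>i. i \<in> I \<Longrightarrow> linear_fraction C (f i)"
  shows "linear_fraction C (\<Prod>i\<in>I. f i)"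
  using assms
  by (induction I rule: infinite_finite_induct) (auto intro: linear_fraction_1 linear_fraction_mult)

lemma linear_fraction_powi:
  assumes "c \<in> C"
  shows "linear_fraction C ((1 - fps_const c * fps_X) powi e)"
proof -
  let ?u = "1 - fps_const c * fps_X :: complex fps"
  have lin: "fps_of_poly [:1, - c:] = ?u"
    by (simp add: fps_of_poly_pCons mult.commute)
  have u: "inverse ?u * ?u = 1" by (rule inverse_mult_eq_1) simp
  \<comment> \<open>Truncation in \<open>nat\<close> makes at least one of the two exponents zero,
    so one formula covers both signs of \<open>e\<close>.\<close>
  have "?u powi e * fps_of_poly ([:1, - c:] ^ nat (- e)) = fps_of_poly ([:1, - c:] ^ nat e)"
  proof (cases "e \<ge> 0")
    case False
    then have "?u powi e * fps_of_poly ([:1, - c:] ^ nat (- e)) = (inverse ?u * ?u) ^ nat (- e)"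
      by (simp only: power_int_def fps_of_poly_power lin power_mult_distrib if_False)
    then show ?thesis using False by (simp only: u) simp
  qed (simp add: power_int_def fps_of_poly_power lin)
  moreover have "\<exists>c\<in>C. c * z = 1"
    if "poly ([:1, - c:] ^ nat e) z = 0 \<or> poly ([:1, - c:] ^ nat (- e)) z = 0" for z
    using that assms by (intro bexI[of _ c]) (auto simp: poly_power mult.commute)
  moreover have "poly ([:1, - c:] ^ nat (- e)) 0 \<noteq> 0" by (simp add: poly_power)
  ultimately show ?thesis unfolding linear_fraction_def by blast
qed

lemma linear_fraction_rational_fps:
  assumes "linear_fraction C Z"
  shows "rational_fps Z"
proof -
  obtain A B where B: "poly B 0 \<noteq> 0" and Z: "Z * fps_of_poly B = fps_of_poly A"
    using assms by (auto simp: linear_fraction_def)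
  have "B \<noteq> 0" using B by auto
  define g where "g = gcd A B"
  have "g \<noteq> 0" using \<open>B \<noteq> 0\<close> by (simp add: g_def)
  define P Q where "P = A div g" and "Q = B div g"
  have A: "A = P * g" and BQ: "B = Q * g" by (simp_all add: P_def Q_def g_def)
  have "coprime P Q" unfolding P_def Q_def g_def using \<open>B \<noteq> 0\<close> by (intro div_gcd_coprime) auto
  moreover have "poly Q 0 \<noteq> 0" using B by (auto simp: BQ)
  moreover have "Z * fps_of_poly Q = fps_of_poly P"
  proof -
    have "(Z * fps_of_poly Q) * fps_of_poly g = fps_of_poly P * fps_of_poly g"
      using Z by (simp add: A BQ fps_of_poly_mult mult.assoc)
    then show ?thesis using \<open>g \<noteq> 0\<close> by simp
  qed
  ultimately show ?thesis by (auto simp: rational_fps_def fps_reduced_fraction_def)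
qed

text \<open>Cross-multiplying gives \<open>P * B = A * Q\<close>. By coprimality \<open>P\<close>
  and \<open>Q\<close> have no common root, so a root of \<open>P\<close> must come from
  \<open>A\<close> and a root of \<open>Q\<close> from \<open>B\<close>.\<close>

lemma fps_reduced_fraction_roots:
  assumes Z: "Z * fps_of_poly B = fps_of_poly A" and PQ: "fps_reduced_fraction Z P Q"
  shows "poly P z = 0 \<Longrightarrow> poly A z = 0" "poly Q z = 0 \<Longrightarrow> poly B z = 0"
proof -
  have P: "fps_of_poly P = Z * fps_of_poly Q" using PQ by (simp add: fps_reduced_fraction_def)
  have "fps_of_poly (P * B) = fps_of_poly (A * Q)"
    by (simp only: fps_of_poly_mult P Z[symmetric] mult_ac)
  then have "P * B = A * Q" by (simp only: fps_of_poly_eq_iff)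
  then have eq: "poly P z * poly B z = poly A z * poly Q z" by (metis poly_mult)
  have cop: "\<not> (poly P z = 0 \<and> poly Q z = 0)"
    using PQ coprime_poly_0[of P Q z] by (auto simp: fps_reduced_fraction_def)
  show "poly P z = 0 \<Longrightarrow> poly A z = 0" "poly Q z = 0 \<Longrightarrow> poly B z = 0"
    using eq cop by auto
qed

lemma linear_fraction_reciprocal_zeros_poles:
  assumes "linear_fraction C Z"
  shows "reciprocal_zeros Z \<union> reciprocal_poles Z \<subseteq> C"
proof
  fix x assume "x \<in> reciprocal_zeros Z \<union> reciprocal_poles Z"
  then obtain z P Q where z: "x = inverse z" "z \<noteq> 0" "fps_reduced_fraction Z P Q" "poly P z = 0 \<or> poly Q z = 0"
    by (auto simp: reciprocal_zeros_def reciprocal_poles_def)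
  obtain A B where Z: "Z * fps_of_poly B = fps_of_poly A"
    and roots: "\<And>z. poly A z = 0 \<or> poly B z = 0 \<Longrightarrow> \<exists>c\<in>C. c * z = 1"
    using assms by (auto simp: linear_fraction_def)
  have "poly A z = 0 \<or> poly B z = 0" using fps_reduced_fraction_roots[OF Z z(3)] z(4) by blast
  then obtain c where c: "c \<in> C" "c * z = 1" using roots by blast
  then have "c = inverse z" by (metis inverse_unique mult.commute)
  then show "x \<in> C" using c(1) z(1) by simp
qed

subsection \<open>Absolute values and the zeta function\<close>

text \<open>\<open>CARD('k)\<close> times any element is zero, so every value of \<psi> is a root of
  unity.\<close>

lemma norm_add_char:
  fixes \<psi> :: "'k::{field,finite} \<Rightarrow> complex"
  assumes "nontrivial_add_char \<psi>"
  shows "norm (\<psi> x) = 1"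
proof -
  have "\<psi> (of_nat i * x) = \<psi> x ^ i" for i
    by (induction i) (simp_all add: nontrivial_add_charD[OF assms] algebra_simps)
  from this[of "CARD('k)"] have "\<psi> x ^ CARD('k) = 1"
    by (simp add: finite_field_of_nat_card nontrivial_add_charD[OF assms])
  then show ?thesis using power_eq_1_iff finite_field_card_gt_1[where 'k='k] by fastforce
qed

lemma cnj_add_char:
  fixes \<psi> :: "'k::{field,finite} \<Rightarrow> complex"
  assumes "nontrivial_add_char \<psi>"
  shows "cnj (\<psi> x) = \<psi> (- x)"
proof -
  have "\<psi> x * cnj (\<psi> x) = 1" using norm_add_char[OF assms, of x] by (simp flip: complex_norm_square)
  moreover have "\<psi> x * \<psi> (- x) = 1"
    using nontrivial_add_charD[OF assms] by (metis add.right_inverse)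
  ultimately show ?thesis by (metis mult_cancel_left mult_zero_left zero_neq_one)
qed

lemma sum_add_char_mult:
  fixes \<psi> :: "'k::{field,finite} \<Rightarrow> complex"
  assumes "nontrivial_add_char \<psi>"
  shows "(\<Sum>v\<in>UNIV - {0}. \<psi> (v * z)) = (if z = 0 then of_nat CARD('k) else 0) - 1"
proof -
  have "(\<Sum>v\<in>UNIV. \<psi> (v * z)) = (if z = 0 then of_nat CARD('k) else 0)"
  proof (cases "z = 0")
    case False
    have "(\<Sum>v\<in>UNIV. \<psi> (v * z)) = (\<Sum>v\<in>UNIV. \<psi> v)"
      by (rule sum.reindex_bij_witness[of _ "\<lambda>v. v / z" "\<lambda>v. v * z"]) (use False in auto)
    then show ?thesis using False sum_add_char[OF assms] by simp
  qed (simp add: nontrivial_add_charD[OF assms])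
  moreover have "(\<Sum>v\<in>UNIV. \<psi> (v * z)) = \<psi> (0 * z) + (\<Sum>v\<in>UNIV - {0}. \<psi> (v * z))"
    by (rule sum.remove) auto
  ultimately show ?thesis by (simp add: nontrivial_add_charD[OF assms] algebra_simps)
qed

lemma sum_mult_char:
  fixes \<chi> :: "'k::{field,finite} \<Rightarrow> complex"
  assumes \<chi>: "mult_char \<chi>" and nt: "\<chi> \<noteq> trivial_mult_char"
  shows "(\<Sum>u\<in>UNIV - {0}. \<chi> u) = 0"
proof -
  obtain v where "\<chi> v \<noteq> trivial_mult_char v" using nt by auto
  then have v: "v \<noteq> 0" "\<chi> v \<noteq> 1" using mult_charD(1)[OF \<chi>] by (auto simp: trivial_mult_char_def split: if_splits)
  have "(\<Sum>u\<in>UNIV - {0}. \<chi> u) = (\<Sum>u\<in>UNIV - {0}. \<chi> (v * u))"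
    by (rule sum.reindex_bij_witness[of _ "\<lambda>u. v * u" "\<lambda>u. u / v"]) (use v in auto)
  also have "\<dots> = \<chi> v * (\<Sum>u\<in>UNIV - {0}. \<chi> u)"
    by (simp add: mult_charD[OF \<chi>] sum_distrib_left)
  finally show ?thesis using v by (simp add: mult_cancel_right1)
qed

text \<open>Expand the Gauss sum times its conjugate and substitute \<open>u = t * v\<close>. The
  inner sum over \<open>v\<close> is \<open>CARD('k) - 1\<close> at \<open>t = 1\<close> and -1
  elsewhere; the constant -1 contributes zero, since a nontrivial character sums to zero.\<close>

lemma norm_gauss_sum:
  fixes \<psi> \<chi> :: "'k::{field,finite} \<Rightarrow> complex"
  assumes \<psi>: "nontrivial_add_char \<psi>" and \<chi>: "mult_char \<chi>"
  shows "norm (gauss_sum \<psi> \<chi>) = (if \<chi> = trivial_mult_char then 1 else sqrt CARD('k))"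
proof (cases "\<chi> = trivial_mult_char")
  case True
  then show ?thesis by (simp add: gauss_sum_trivial[OF \<psi>])
next
  case False
  let ?U = "UNIV - {0 :: 'k}"
  let ?G = "gauss_sum \<psi> \<chi>"
  have "?G * cnj ?G = (\<Sum>v\<in>?U. \<Sum>u\<in>?U. (\<chi> u * \<psi> u) * cnj (\<chi> v * \<psi> v))"
    by (simp only: gauss_sum_def cnj_sum sum_product) (rule sum.swap)
  also have "\<dots> = (\<Sum>v\<in>?U. \<Sum>t\<in>?U. \<chi> t * \<psi> (v * (t - 1)))"
  proof (rule sum.cong[OF refl])
    fix v assume v: "v \<in> ?U"
    have "(\<Sum>u\<in>?U. (\<chi> u * \<psi> u) * cnj (\<chi> v * \<psi> v)) = (\<Sum>t\<in>?U. (\<chi> (t * v) * \<psi> (t * v)) * cnj (\<chi> v * \<psi> v))"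
      by (rule sum.reindex_bij_witness[of _ "\<lambda>t. t * v" "\<lambda>u. u / v"]) (use v in auto)
    also have "\<dots> = (\<Sum>t\<in>?U. \<chi> t * \<psi> (v * (t - 1)))"
    proof (rule sum.cong[OF refl])
      fix t
      have "(\<chi> (t * v) * \<psi> (t * v)) * cnj (\<chi> v * \<psi> v) = \<chi> t * (\<chi> v * cnj (\<chi> v)) * (\<psi> (t * v) * \<psi> (- v))"
        by (simp add: mult_charD[OF \<chi>] cnj_add_char[OF \<psi>])
      also have "\<chi> v * cnj (\<chi> v) = 1" using v by (intro mult_char_mult_cnj[OF \<chi>]) auto
      also have "\<psi> (t * v) * \<psi> (- v) = \<psi> (v * (t - 1))"
        by (simp add: nontrivial_add_charD(2)[OF \<psi>, symmetric] algebra_simps)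
      finally show "(\<chi> (t * v) * \<psi> (t * v)) * cnj (\<chi> v * \<psi> v) = \<chi> t * \<psi> (v * (t - 1))" by simp
    qed
    finally show "(\<Sum>u\<in>?U. (\<chi> u * \<psi> u) * cnj (\<chi> v * \<psi> v)) = (\<Sum>t\<in>?U. \<chi> t * \<psi> (v * (t - 1)))" .
  qed
  also have "\<dots> = (\<Sum>t\<in>?U. \<chi> t * (\<Sum>v\<in>?U. \<psi> (v * (t - 1))))"
    unfolding sum_distrib_left by (rule sum.swap)
  also have "\<dots> = (\<Sum>t\<in>?U. \<chi> t * (if t = 1 then of_nat CARD('k) else 0)) - (\<Sum>t\<in>?U. \<chi> t)"
    unfolding sum_add_char_mult[OF \<psi>] by (simp add: right_diff_distrib sum_subtractf)
  also have "(\<Sum>t\<in>?U. \<chi> t * (if t = 1 then of_nat CARD('k) else 0)) = of_nat CARD('k)"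
    by (simp add: mult_charD[OF \<chi>] if_distrib[of "\<lambda>z. _ * z"] cong: if_cong)
  finally have "of_real ((norm ?G)\<^sup>2) = (of_nat CARD('k) :: complex)"
    using sum_mult_char[OF \<chi> False] by (simp only: complex_norm_square diff_zero)
  then have "(norm ?G)\<^sup>2 = of_nat CARD('k)"
    by (metis of_real_eq_iff of_real_of_nat_eq)
  then show ?thesis using False real_sqrt_unique[of "norm ?G" "real CARD('k)"] by simp
qed

lemma norm_omega:
  fixes \<psi> :: "'k::{field,finite} \<Rightarrow> complex"
  assumes \<psi>: "nontrivial_add_char \<psi>" and S: "finite S" and a: "\<And>i. i \<in> S \<Longrightarrow> a i \<noteq> 0"
    and \<chi>: "\<chi> \<in> char_tuples m S"
  shows "norm (omega \<psi> a S \<chi>) = sqrt CARD('k) ^ nontrivial_count S \<chi>"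
proof -
  have mc: "mult_char (\<chi> i)" if "i \<in> S" for i using \<chi> that by (auto simp: char_tuples_def)
  have "norm (omega \<psi> a S \<chi>) = (\<Prod>i\<in>S. if \<chi> i \<noteq> trivial_mult_char then sqrt CARD('k) else 1)"
    unfolding omega_def prod_norm[symmetric]
    by (intro prod.cong refl) (simp add: norm_mult norm_gauss_sum[OF \<psi> mc] norm_mult_char[OF mc a])
  also have "\<dots> = sqrt CARD('k) ^ nontrivial_count S \<chi>"
    using S by (simp only: prod.inter_filter[symmetric] prod_constant nontrivial_count_def)
  finally show ?thesis .
qed

text \<open>By the orbit count formula the series being exponentiated is an integral combination of
  logarithms of linear factors, so its exponential is the product with negated exponents.\<close>

lemma twist_zeta_eq:
  fixes a :: "nat \<Rightarrow> 'k::{field,finite}"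
  assumes \<psi>: "nontrivial_add_char \<psi>"
    and w: "\<And>i. i \<le> n \<Longrightarrow> w i dvd CARD('k) - 1" and md: "\<And>i. i \<le> n \<Longrightarrow> m i dvd CARD('k) - 1"
    and deg: "\<And>i. i \<le> n \<Longrightarrow> m i * w i = d" and m: "\<And>i. i \<le> n \<Longrightarrow> m i > 0"
    and a: "\<And>i. i \<le> n \<Longrightarrow> a i \<noteq> 0"
  shows "twist_zeta n w a m = (\<Prod>S\<in>Pow {..n} - {{}}.
          (\<Prod>j = 0..card S - 1.
             (1 - fps_const (of_nat CARD('k) powi (int j - 1)) * fps_X)
               powi (- ((-1) ^ (card S - 1 - j) * int ((card S - 1) choose j)
                        * int (weight_gcd w S)))) *
          (\<Prod>\<chi>\<in>char_tuples m S.
             (1 - fps_const (inverse (of_nat CARD('k)) * omega \<psi> a S \<chi>) * fps_X)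
               powi (- ((-1) ^ card S * int (weight_gcd w S)))))"
proof -
  let ?L = "\<lambda>k c. of_int k * fps_power_log c"
  let ?k1 = "\<lambda>S j. (-1) ^ (card S - 1 - j) * int ((card S - 1) choose j) * int (weight_gcd w S)"
  let ?k2 = "\<lambda>S. (-1) ^ card S * int (weight_gcd w S)"
  let ?c1 = "\<lambda>j. of_nat CARD('k) powi (int j - 1) :: complex"
  let ?c2 = "\<lambda>S \<chi>. inverse (of_nat CARD('k)) * omega \<psi> a S \<chi>"
  have nth: "fps_nth (?L k c) r = of_int k * c ^ r / of_nat r" if "r > 0" for k c r
    using that by (simp add: fps_power_log_def flip: fps_of_int)
  have nth0: "fps_nth (?L k c) 0 = 0" for k c
    by (simp add: fps_power_log_def)
  have "Abs_fps (\<lambda>r. if r = 0 then 0 else of_nat (orbit_count n w a m r) / of_nat r) =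
    (\<Sum>S\<in>Pow {..n} - {{}}. (\<Sum>j = 0..card S - 1. ?L (?k1 S j) (?c1 j)) +
      (\<Sum>\<chi>\<in>char_tuples m S. ?L (?k2 S) (?c2 S \<chi>)))" (is "?lhs = ?rhs")
  proof (rule fps_ext)
    fix r
    show "fps_nth ?lhs r = fps_nth ?rhs r"
    proof (cases "r = 0")
      case False
      then have r: "r > 0" by simp
      have "fps_nth ?rhs r = (\<Sum>S\<in>Pow {..n} - {{}}.
          (\<Sum>j = 0..card S - 1. of_int (?k1 S j) * ?c1 j ^ r / of_nat r) +
          (\<Sum>\<chi>\<in>char_tuples m S. of_int (?k2 S) * ?c2 S \<chi> ^ r / of_nat r))"
        by (simp only: fps_sum_nth fps_add_nth nth[OF r])
      also have "\<dots> = of_nat (orbit_count n w a m r) / of_nat r"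
        using orbit_count_formula[OF \<psi> r w md deg m a]
        by (simp only: sum_divide_distrib add_divide_distrib)
      finally show ?thesis using False by simp
    next
      case True
      have "fps_nth ?rhs 0 = 0"
        by (simp only: fps_sum_nth fps_add_nth nth0 sum.neutral_const add_0_left)
      then show ?thesis using True by simp
    qed
  qed
  then show ?thesis
    unfolding twist_zeta_def
    by (simp only: fps_exp_compose_sum fps_exp_compose_add fps_exp_compose_int_power_log fps_sum_nth
        fps_add_nth nth0 sum.neutral_const add_0_left)
qed

theorem theorem8p3:
  fixes n d q :: nat
    and w m :: "nat \<Rightarrow> nat"
    and a :: "nat \<Rightarrow> 'k::{field,finite}"
    and \<psi> :: "'k \<Rightarrow> complex"
  assumes q: "q = CARD('k)"
    and w_pos: "\<And>i. i \<le> n \<Longrightarrow> w i > 0"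
    and m_pos: "\<And>i. i \<le> n \<Longrightarrow> m i > 0"
    and a_nonzero: "\<And>i. i \<le> n \<Longrightarrow> a i \<noteq> 0"
    and degree: "\<And>i. i \<le> n \<Longrightarrow> m i * w i = d"
    and q_cong: "[q = 1] (mod d)"
    and psi: "nontrivial_add_char \<psi>"
  shows
    "twist_zeta n w a m =
       (\<Prod>S\<in>Pow {..n} - {{}}.
          (\<Prod>j = 0..card S - 1.
             (1 - fps_const (of_nat q powi (int j - 1)) * fps_X)
               powi (- ((-1) ^ (card S - 1 - j) * int ((card S - 1) choose j)
                        * int (weight_gcd w S)))) *
          (\<Prod>\<chi>\<in>char_tuples m S.
             (1 - fps_const (inverse (of_nat q) * omega \<psi> a S \<chi>) * fps_X)
               powi (- ((-1) ^ card S * int (weight_gcd w S)))))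
     \<and> rational_fps (twist_zeta n w a m)
     \<and> reciprocal_zeros (twist_zeta n w a m) \<union> reciprocal_poles (twist_zeta n w a m)
         \<subseteq> {of_nat q powi (int j - 1) | j. j \<le> n}
            \<union> {inverse (of_nat q) * omega \<psi> a S \<chi> | S \<chi>.
                  S \<subseteq> {..n} \<and> S \<noteq> {} \<and> \<chi> \<in> char_tuples m S}
     \<and> (\<forall>S \<chi>. S \<subseteq> {..n} \<and> S \<noteq> {} \<and> \<chi> \<in> char_tuples m S \<longrightarrow>
          norm (inverse (of_nat q) * omega \<psi> a S \<chi>)
            = real q powr (real (nontrivial_count S \<chi>) / 2 - 1))"
    (is "?zeta \<and> _ \<and> _ \<subseteq> ?C \<and> ?norms")
proof -
  have q1: "q > 1" unfolding q by (rule finite_field_card_gt_1)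
  \<comment> \<open>The congruence enters only through this divisibility:
    \<open>d = m i * w i\<close>, so both exponents and weights divide \<open>CARD('k) - 1\<close>,
    which provides the characters and the stabilisers.\<close>
  have "d dvd CARD('k) - 1"
    using q_cong q1 unfolding q by (metis cong_altdef_nat less_imp_le_nat)
  then have w: "w i dvd CARD('k) - 1" and m: "m i dvd CARD('k) - 1" if "i \<le> n" for i
    using degree[OF that] by (metis dvd_triv_left dvd_triv_right dvd_trans)+
  have zeta: ?zeta
    unfolding q by (rule twist_zeta_eq[OF psi w m degree m_pos a_nonzero])
  have lin: "linear_fraction ?C (twist_zeta n w a m)"
  proof (subst zeta, intro linear_fraction_prod linear_fraction_mult linear_fraction_powi)
    fix S j assume S: "S \<in> Pow {..n} - {{}}" and j: "j \<in> {0..card S - 1}"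
    \<comment> \<open>\<open>{..n}\<close> has \<open>n + 1\<close> elements, so
      \<open>j \<le> card S - 1\<close> gives \<open>j \<le> n\<close>.\<close>
    have "card S \<le> card {..n}" using S by (intro card_mono) auto
    then show "of_nat q powi (int j - 1) \<in> ?C" using j by auto
  qed auto
  have norms: ?norms
  proof (intro allI impI)
    fix S and \<chi> :: "nat \<Rightarrow> 'k \<Rightarrow> complex"
    assume S: "S \<subseteq> {..n} \<and> S \<noteq> {} \<and> \<chi> \<in> char_tuples m S"
    have "norm (inverse (of_nat q) * omega \<psi> a S \<chi>) = sqrt q ^ nontrivial_count S \<chi> / q"
    proof -
      have "finite S" "a i \<noteq> 0" if "i \<in> S" for i
        using S that a_nonzero[of i] finite_subset[of S "{..n}"] by auto
      then have "norm (omega \<psi> a S \<chi>) = sqrt CARD('k) ^ nontrivial_count S \<chi>"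
        using S by (intro norm_omega[OF psi]) auto
      then show ?thesis by (simp add: norm_mult norm_inverse q divide_inverse mult.commute)
    qed
    also have "sqrt q ^ nontrivial_count S \<chi> = q powr (real (nontrivial_count S \<chi>) / 2)"
      using q1 by (simp add: powr_half_sqrt[symmetric] powr_powr flip: powr_realpow)
    finally show "norm (inverse (of_nat q) * omega \<psi> a S \<chi>)
        = real q powr (real (nontrivial_count S \<chi>) / 2 - 1)"
      using q1 by (simp add: powr_diff)
  qed
  show ?thesis
    by (rule conjI[OF zeta conjI[OF linear_fraction_rational_fps[OF lin]
          conjI[OF linear_fraction_reciprocal_zeros_poles[OF lin] norms]]])
qed

end
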